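(* Let $M$ be a binary gammoid. Then the element splitting matroid $M_H'$ is a binary gammoid for every $H \subseteq E(M)$ with $|H| \geq 3$ if and only if $M$ does not contain a minor isomorphic to $M(G_6)$.
   Context: A binary gammoid is a gammoid that is representable over $GF(2)$. $M(G)$ denotes the cycle matroid of a graph $G$ (parallel edges allowed). Element splitting: let $B$ be a binary matroid, $H \subseteq E(B)$, and let $A$ be a matrix over $GF(2)$ representing $B$. Let $A_H'$ be obtained from $A$ by adjoining a new last row whose entries are $1$ in the columns corresponding to the elements of $H$ and $0$ elsewhere, and then adjoining one new column (labelled by a new element $a \notin E(B)$) whose entries are all $0$ except for the last row, where the entry is $1$. The element splitting matroid $B_H'$ is the vector matroid of $A_H'$, on the ground set $E(B) \cup \{a\}$. $G_6$ is the graph on three vertices $u,v,w$ with five edges: two parallel edges joining $u$ and $v$, two parallel edges joining $u$ and $w$, and one edge joining $v$ and $w$. *)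

theory Defs
  imports "HOL-Library.Z2" "Graph_Theory.Arc_Walk"
begin

section \<open>Finite matroids\<close>

record 'a pre_matroid =
  ground :: "'a set"
  indeps :: "'a set set"

locale matroid =
  fixes M :: "'a pre_matroid"
  assumes finite_ground: "finite (ground M)"
    and indeps_subset_ground: "I \<in> indeps M \<Longrightarrow> I \<subseteq> ground M"
    and empty_indep: "{} \<in> indeps M"
    and indep_subset: "I \<in> indeps M \<Longrightarrow> J \<subseteq> I \<Longrightarrow> J \<in> indeps M"
    and augment: "I \<in> indeps M \<Longrightarrow> J \<in> indeps M \<Longrightarrow> card I < card J \<Longrightarrow>
      \<exists>e \<in> J - I. insert e I \<in> indeps M"

definition matroid_iso :: "'a pre_matroid \<Rightarrow> 'b pre_matroid \<Rightarrow> bool" where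
  "matroid_iso M N \<longleftrightarrow> (\<exists>\<phi>. bij_betw \<phi> (ground M) (ground N) \<and>
     (\<forall>X \<subseteq> ground M. X \<in> indeps M \<longleftrightarrow> \<phi> ` X \<in> indeps N))"

definition matroid_restrict :: "'a pre_matroid \<Rightarrow> 'a set \<Rightarrow> 'a pre_matroid" where
  "matroid_restrict M S = \<lparr>ground = ground M \<inter> S, indeps = {I \<in> indeps M. I \<subseteq> S}\<rparr>"

definition matroid_delete :: "'a pre_matroid \<Rightarrow> 'a set \<Rightarrow> 'a pre_matroid" where
  "matroid_delete M D = matroid_restrict M (ground M - D)"

definition basis_of :: "'a pre_matroid \<Rightarrow> 'a set \<Rightarrow> 'a set \<Rightarrow> bool" where
  "basis_of M T J \<longleftrightarrow> J \<in> indeps M \<and> J \<subseteq> T \<and>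
     (\<forall>K \<in> indeps M. J \<subseteq> K \<and> K \<subseteq> T \<longrightarrow> K = J)"

definition matroid_contract :: "'a pre_matroid \<Rightarrow> 'a set \<Rightarrow> 'a pre_matroid" where
  "matroid_contract M T =
     \<lparr>ground = ground M - T,
      indeps = {I. I \<subseteq> ground M - T \<and> (\<exists>J. basis_of M T J \<and> I \<union> J \<in> indeps M)}\<rparr>"

definition matroid_minor :: "'a pre_matroid \<Rightarrow> 'a pre_matroid \<Rightarrow> bool" where
  "matroid_minor N M \<longleftrightarrow> (\<exists>C D. C \<subseteq> ground M \<and> D \<subseteq> ground M \<and> C \<inter> D = {} \<and>
     N = matroid_delete (matroid_contract M C) D)"

section \<open>Cycle matroids of multigraphs\<close>

text \<open>Undirected graphs with loops and parallel edges; an edge is a loop iff its set of ends is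
  a singleton.\<close>

record ('v, 'e) multigraph =
  vertices :: "'v set"
  edges :: "'e set"
  ends :: "'e \<Rightarrow> 'v set"

locale fin_multigraph =
  fixes G :: "('v, 'e) multigraph"
  assumes finite_vertices: "finite (vertices G)"
    and finite_edges: "finite (edges G)"
    and ends_subset: "e \<in> edges G \<Longrightarrow> ends G e \<subseteq> vertices G"
    and card_ends: "e \<in> edges G \<Longrightarrow> card (ends G e) \<in> {1, 2}"

text \<open>The cycle runs through the vertices \<open>vs\<close> and back to the first one. Length 1 gives the loops
  and length 2 the pairs of parallel edges.\<close>

definition is_cycle :: "('v, 'e) multigraph \<Rightarrow> 'v list \<Rightarrow> 'e list \<Rightarrow> bool" where
  "is_cycle G vs es \<longleftrightarrow> es \<noteq> [] \<and> length vs = length es \<and> distinct vs \<and> distinct es \<and>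
     set vs \<subseteq> vertices G \<and> set es \<subseteq> edges G \<and>
     (\<forall>i < length es. ends G (es ! i) = {vs ! i, vs ! (Suc i mod length es)})"

definition cycle_matroid :: "('v, 'e) multigraph \<Rightarrow> 'e pre_matroid" where
  "cycle_matroid G =
     \<lparr>ground = edges G,
      indeps = {X. X \<subseteq> edges G \<and> \<not> (\<exists>vs es. is_cycle G vs es \<and> set es \<subseteq> X)}\<rparr>"

text \<open>The vertices \<open>u, v, w\<close> are \<open>0, 1, 2\<close>.\<close>

definition G6 :: "(nat, nat) multigraph" where
  "G6 = \<lparr>vertices = {0, 1, 2}, edges = {0, 1, 2, 3, 4},
     ends = (\<lambda>i. [{0, 1}, {0, 1}, {0, 2}, {0, 2}, {1, 2}] ! i)\<rparr>"

lemma fin_multigraph_G6: "fin_multigraph G6"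
  by unfold_locales (auto simp: G6_def numeral_eq_Suc)

section \<open>Gammoids\<close>

text \<open>\<open>X\<close> is linked into \<open>B\<close>: there are pairwise vertex-disjoint directed paths, one starting at each
  element of \<open>X\<close>, that end in \<open>B\<close>. A path may be trivial.\<close>

definition linked_into :: "('v, 'e) pre_digraph \<Rightarrow> 'v set \<Rightarrow> 'v set \<Rightarrow> bool" where
  "linked_into D X B \<longleftrightarrow> (\<exists>p t.
     (\<forall>x \<in> X. pre_digraph.apath D x (p x) (t x) \<and> t x \<in> B) \<and>
     (\<forall>x \<in> X. \<forall>y \<in> X. x \<noteq> y \<longrightarrow>
        set (pre_digraph.awalk_verts D x (p x)) \<inter> set (pre_digraph.awalk_verts D y (p y)) = {}))"

definition strict_gammoid :: "('v, 'e) pre_digraph \<Rightarrow> 'v set \<Rightarrow> 'v pre_matroid" where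
  "strict_gammoid D B =
     \<lparr>ground = verts D, indeps = {X. X \<subseteq> verts D \<and> linked_into D X B}\<rparr>"

text \<open>Every finite digraph is isomorphic to one with vertices and arcs in \<^typ>\<open>nat\<close>, so using
  \<^typ>\<open>nat\<close> is no restriction. The type of the elements of \<open>M\<close> would not do: it may be too small to
  hold the vertices outside \<open>S\<close>.\<close>

definition gammoid :: "'a pre_matroid \<Rightarrow> bool" where
  "gammoid M \<longleftrightarrow> matroid M \<and>
     (\<exists>(D :: (nat, nat) pre_digraph) B S. fin_digraph D \<and> B \<subseteq> verts D \<and> S \<subseteq> verts D \<and>
        matroid_iso M (matroid_restrict (strict_gammoid D B) S))"

section \<open>Representations over a field\<close>

text \<open>A matrix with rows \<open>0, \<dots>, m - 1\<close> and columns labelled by \<open>E\<close> is given by its number of rows \<open>m\<close>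
  and a function \<open>A\<close> sending a row index and a label to an entry. Independence is that of the
  family of columns, so equal columns with different labels are dependent.\<close>

definition cols_indep :: "nat \<Rightarrow> (nat \<Rightarrow> 'a \<Rightarrow> 'f::field) \<Rightarrow> 'a set \<Rightarrow> bool" where
  "cols_indep m A X \<longleftrightarrow>
     (\<forall>c. (\<forall>i<m. (\<Sum>e\<in>X. c e * A i e) = 0) \<longrightarrow> (\<forall>e\<in>X. c e = 0))"

definition vector_matroid :: "nat \<Rightarrow> (nat \<Rightarrow> 'a \<Rightarrow> 'f::field) \<Rightarrow> 'a set \<Rightarrow> 'a pre_matroid" where
  "vector_matroid m A E = \<lparr>ground = E, indeps = {X. X \<subseteq> E \<and> cols_indep m A X}\<rparr>"

definition represents :: "nat \<Rightarrow> (nat \<Rightarrow> 'a \<Rightarrow> 'f::field) \<Rightarrow> 'a pre_matroid \<Rightarrow> bool" where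
  "represents m A M \<longleftrightarrow> M = vector_matroid m A (ground M)"

text \<open>\<^typ>\<open>bit\<close> is the field \<open>GF(2)\<close>.\<close>

definition binary :: "'a pre_matroid \<Rightarrow> bool" where
  "binary M \<longleftrightarrow> matroid M \<and> (\<exists>m (A :: nat \<Rightarrow> 'a \<Rightarrow> bit). represents m A M)"

definition binary_gammoid :: "'a pre_matroid \<Rightarrow> bool" where
  "binary_gammoid M \<longleftrightarrow> gammoid M \<and> binary M"

section \<open>Element splitting\<close>

text \<open>The ground set \<open>E \<union> {a}\<close> lives in \<^typ>\<open>'a option\<close>: an element \<open>e\<close> of \<open>E\<close> becomes \<open>Some e\<close>, and
  \<^term>\<open>None\<close> is the new element \<open>a\<close>, which is thus never in \<open>E\<close>. The new row has index \<open>m\<close>.\<close>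

definition split_matrix :: "nat \<Rightarrow> (nat \<Rightarrow> 'a \<Rightarrow> bit) \<Rightarrow> 'a set \<Rightarrow> nat \<Rightarrow> 'a option \<Rightarrow> bit" where
  "split_matrix m A H i x =
     (case x of
        Some e \<Rightarrow> if i = m then (if e \<in> H then 1 else 0) else A i e
      | None \<Rightarrow> if i = m then 1 else 0)"

definition split_vector_matroid ::
    "nat \<Rightarrow> (nat \<Rightarrow> 'a \<Rightarrow> bit) \<Rightarrow> 'a set \<Rightarrow> 'a set \<Rightarrow> 'a option pre_matroid" where
  "split_vector_matroid m A E H =
     vector_matroid (Suc m) (split_matrix m A H) (insert None (Some ` E))"

text \<open>The matrix is chosen arbitrarily; by lemma \<open>element_splitting_eq\<close> below, the choice does not
  matter.\<close>

definition element_splitting :: "'a pre_matroid \<Rightarrow> 'a set \<Rightarrow> 'a option pre_matroid" where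
  "element_splitting M H =
     (let (m, A) = (SOME (m, A). represents m A M)
      in split_vector_matroid m A (ground M) H)"

definition null_cols :: "nat \<Rightarrow> (nat \<Rightarrow> 'a \<Rightarrow> bit) \<Rightarrow> 'a set \<Rightarrow> bool" where
  "null_cols m A S \<longleftrightarrow> (\<forall>i<m. (\<Sum>e\<in>S. A i e) = 0)"

lemma cols_indep_iff_null_cols:
  fixes A :: "nat \<Rightarrow> 'a \<Rightarrow> bit"
  assumes "finite X"
  shows "cols_indep m A X \<longleftrightarrow> (\<forall>S\<subseteq>X. null_cols m A S \<longrightarrow> S = {})"
proof -
  have supp: "(\<Sum>e\<in>X. c e * A i e) = (\<Sum>e\<in>{e\<in>X. c e = 1}. A i e)" for c i
  proof -
    have "(\<Sum>e\<in>X. c e * A i e) = (\<Sum>e\<in>X. if c e = 1 then A i e else 0)"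
      by (rule sum.cong) auto
    then show ?thesis
      using assms by (simp add: sum.inter_filter)
  qed
  show ?thesis
  proof (intro iffI allI impI)
    fix S assume ind: "cols_indep m A X" and S: "S \<subseteq> X" and null: "null_cols m A S"
    let ?c = "\<lambda>e. if e \<in> S then 1 else (0::bit)"
    have "{e\<in>X. ?c e = 1} = S" using S by auto
    then have "\<forall>i<m. (\<Sum>e\<in>X. ?c e * A i e) = 0"
      using null supp[of ?c] unfolding null_cols_def by metis
    then have "\<forall>e\<in>X. ?c e = 0"
      using ind[unfolded cols_indep_def, rule_format, of ?c] by blast
    then show "S = {}" using S by (auto split: if_splits)
  next
    assume R: "\<forall>S\<subseteq>X. null_cols m A S \<longrightarrow> S = {}"
    show "cols_indep m A X"
      unfolding cols_indep_def
    proof (intro allI impI)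
      fix c assume "\<forall>i<m. (\<Sum>e\<in>X. c e * A i e) = 0"
      then have "null_cols m A {e\<in>X. c e = 1}"
        unfolding null_cols_def supp .
      then have "{e\<in>X. c e = 1} = {}"
        using R[rule_format, of "{e\<in>X. c e = 1}"] by (simp only: Collect_restrict)
      then show "\<forall>e\<in>X. c e = 0" by (metis (mono_tags, lifting) bit.exhaust empty_iff mem_Collect_eq)
    qed
  qed
qed

lemma null_cols_determined:
  fixes A B :: "nat \<Rightarrow> 'a \<Rightarrow> bit"
  assumes "finite S"
    and "\<And>X. X \<subseteq> S \<Longrightarrow> cols_indep m A X \<longleftrightarrow> cols_indep n B X"
    and "null_cols m A S"
  shows "null_cols n B S"
  using assms
proof (induction S rule: finite_psubset_induct)
  case (psubset S)
  have fin: "finite X" if "X \<subseteq> S" for X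
    using that psubset.hyps finite_subset by blast
  have dep: "(\<exists>T\<subseteq>X. T \<noteq> {} \<and> null_cols m A T) \<longleftrightarrow> (\<exists>T\<subseteq>X. T \<noteq> {} \<and> null_cols n B T)"
    if "X \<subseteq> S" for X
    using psubset.prems(1)[OF that] cols_indep_iff_null_cols[OF fin[OF that]] by metis
  show ?case
  proof (cases "S = {}")
    case True
    then show ?thesis by (simp add: null_cols_def)
  next
    case False
    then have "\<exists>T. T \<subseteq> S \<and> T \<noteq> {} \<and> null_cols n B T"
      using dep[of S] psubset.prems(2) by blast
    then obtain T where T: "T \<subseteq> S" "T \<noteq> {}" "null_cols n B T"
      and min: "\<And>U. U \<subseteq> S \<and> U \<noteq> {} \<and> null_cols n B U \<Longrightarrow> card T \<le> card U"
      using exists_least_iff[of "\<lambda>k. \<exists>T. T \<subseteq> S \<and> T \<noteq> {} \<and> null_cols n B T \<and> card T = k"]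
      by (metis not_less)
    obtain T' where T': "T' \<subseteq> T" "T' \<noteq> {}" "null_cols m A T'"
      using dep[of T] T by blast
    obtain T'' where T'': "T'' \<subseteq> T'" "T'' \<noteq> {}" "null_cols n B T''"
      using dep[of T'] T' T(1) by blast
    have "T'' = T"
      using min[of T''] T'' T'(1) T(1) fin[OF T(1)] by (meson card_seteq order_trans)
    then have nullT: "null_cols m A T" using T' T'' by auto
    have split: "(\<Sum>e\<in>S. f e) = (\<Sum>e\<in>S - T. f e) + (\<Sum>e\<in>T. f e)" for f :: "'a \<Rightarrow> bit"
      using T(1) psubset.hyps by (rule sum.subset_diff)
    have "null_cols m A (S - T)"
      using psubset.prems(2) nullT split unfolding null_cols_def
      by (metis add.right_neutral)
    then have "null_cols n B (S - T)"
      using psubset.IH[of "S - T"] psubset.prems(1) T by blast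
    then show ?thesis
      using T(3) split unfolding null_cols_def by simp
  qed
qed

lemma null_cols_split_matrix:
  assumes "finite E" "S \<subseteq> insert None (Some ` E)"
  shows "null_cols (Suc m) (split_matrix m A H) S \<longleftrightarrow>
    null_cols m A {e. Some e \<in> S} \<and>
    (\<Sum>x\<in>S. case x of None \<Rightarrow> 1 | Some e \<Rightarrow> if e \<in> H then 1 else (0::bit)) = 0"
proof -
  have fin: "finite S" using assms finite_subset by blast
  have "(\<Sum>x\<in>S. split_matrix m A H i x) = (\<Sum>e\<in>{e. Some e \<in> S}. A i e)" if "i < m" for i
  proof -
    have "(\<Sum>x\<in>S. split_matrix m A H i x) = (\<Sum>x\<in>Some ` {e. Some e \<in> S}. split_matrix m A H i x)"
    proof (rule sum.mono_neutral_right[OF fin])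
      show "\<forall>x\<in>S - Some ` {e. Some e \<in> S}. split_matrix m A H i x = 0"
      proof
        fix x assume "x \<in> S - Some ` {e. Some e \<in> S}"
        then show "split_matrix m A H i x = 0"
          using that by (cases x) (auto simp: split_matrix_def)
      qed
    qed auto
    also have "\<dots> = (\<Sum>e\<in>{e. Some e \<in> S}. A i e)"
      using that by (simp add: sum.reindex split_matrix_def)
    finally show ?thesis .
  qed
  moreover have "(\<Sum>x\<in>S. split_matrix m A H m x) =
      (\<Sum>x\<in>S. case x of None \<Rightarrow> 1 | Some e \<Rightarrow> if e \<in> H then 1 else (0::bit))"
    by (rule sum.cong) (auto simp: split_matrix_def split: option.splits)
  ultimately show ?thesis
    unfolding null_cols_def by (auto simp: less_Suc_eq)
qed

lemma element_splitting_eq: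
  fixes A :: "nat \<Rightarrow> 'a \<Rightarrow> bit"
  assumes fin: "finite (ground M)" and rep: "represents m A M"
  shows "element_splitting M H = split_vector_matroid m A (ground M) H"
proof -
  define E where "E = ground M"
  have finE: "finite E" using fin E_def by simp
  obtain n and B :: "nat \<Rightarrow> 'a \<Rightarrow> bit" where nB: "(SOME (m, A). represents m A M) = (n, B)" by fastforce
  have repB: "represents n B M"
    using someI[of "\<lambda>(m, A :: nat \<Rightarrow> 'a \<Rightarrow> bit). represents m A M" "(m, A)", unfolded nB] rep by simp
  have same: "cols_indep m A X \<longleftrightarrow> cols_indep n B X" if "X \<subseteq> E" for X
  proof -
    have "X \<in> indeps M \<longleftrightarrow> cols_indep m A X"
      using rep that unfolding represents_def vector_matroid_def E_def
      by (metis (mono_tags, lifting) mem_Collect_eq pre_matroid.select_convs(2))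
    moreover have "X \<in> indeps M \<longleftrightarrow> cols_indep n B X"
      using repB that unfolding represents_def vector_matroid_def E_def
      by (metis (mono_tags, lifting) mem_Collect_eq pre_matroid.select_convs(2))
    ultimately show ?thesis by simp
  qed
  have null: "null_cols m A S \<longleftrightarrow> null_cols n B S" if "S \<subseteq> E" for S
    using null_cols_determined[of S m A n B] null_cols_determined[of S n B m A] same that
      finite_subset[OF that finE] by (meson order_trans)
  have "cols_indep (Suc m) (split_matrix m A H) X \<longleftrightarrow> cols_indep (Suc n) (split_matrix n B H) X"
    if X: "X \<subseteq> insert None (Some ` E)" for X
  proof -
    have finX: "finite X" using X finE finite_subset by blast
    have "null_cols (Suc m) (split_matrix m A H) S \<longleftrightarrow> null_cols (Suc n) (split_matrix n B H) S"
      if "S \<subseteq> X" for S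
    proof -
      have S: "S \<subseteq> insert None (Some ` E)" using that X by blast
      then have "{e. Some e \<in> S} \<subseteq> E" by auto
      then show ?thesis
        using null null_cols_split_matrix[OF finE S] by metis
    qed
    then show ?thesis
      using cols_indep_iff_null_cols[OF finX] by metis
  qed
  then show ?thesis
    unfolding element_splitting_def nB split_vector_matroid_def vector_matroid_def E_def[symmetric]
    by auto
qed

end

theory Submission
  imports Defs
begin

text \<open>
  A binary matroid is determined by its cycle space, the set \<open>Z\<close> of all sets of columns with sum
  zero: a set is independent iff it contains no nonempty member of \<open>Z\<close>. Element splitting lifts every
  \<open>S \<in> Z\<close> to \<open>S\<close> or to \<open>S \<union> {a}\<close>, so that the new element \<open>a\<close> records the parity of \<open>S \<inter> H\<close>
  (\<open>binary_cycle_space\<close>). Both directions are proved on the level of \<open>Z\<close>.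

  For gammoids, linkings are traded for matchings. Moving every vertex one step along its path turns a
  linking of \<open>X\<close> into \<open>B\<close> into an injection from the vertices outside \<open>B\<close> to the vertices outside
  \<open>X\<close> that moves along arcs or stays put; conversely, iterating such an injection from the points of \<open>X\<close>
  traces out disjoint paths that end in \<open>B\<close> (\<open>linked_into_iff_routes\<close>). This is the duality between
  strict gammoids and transversal matroids.

  If \<open>M\<close> has a minor \<open>M(G6)\<close>, split over three suitable elements of this minor. As \<open>M(G6)\<close> is
  \<open>M(K4)\<close> with one edge contracted, the splitting then has a minor \<open>M(K4)\<close>. Gammoids are base
  orderable, because the alternating paths of two matchings pair up the elements in which two bases
  differ (\<open>gammoid_exchange\<close>). \<open>M(K4)\<close> is not: two complementary paths of length three with no
  compatible pairing remain bad when both are enlarged by a basis of the contracted set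
  (\<open>splitting_not_gammoid\<close>).

  Suppose now that \<open>M\<close> has no minor \<open>M(G6)\<close>. Fix a basis \<open>B\<close> and write the fundamental circuit of
  \<open>e \<notin> B\<close> as \<open>{e} \<union> F e\<close>. Two rows and three columns of the representing matrix relative to \<open>B\<close> give a
  minor on five elements, and two patterns of entries give \<open>M(G6)\<close>
  (\<open>G6_minor_of_fundamental\<close>). Excluding them forces the sets \<open>F e\<close> to fall into pairwise disjoint
  sunflowers (\<open>sunflower_if_no_G6\<close>): the elements outside \<open>B\<close> split into bunches, and inside a bunch any
  two sets \<open>F e\<close> meet exactly in a common core. Each bunch is therefore a generalized theta graph, whose
  parallel paths are the core, possibly of length zero, and the petals \<open>{e} \<union> (F e - core)\<close>. A set is independent in \<open>M\<close> iff
  it contains at most one whole path of each theta graph. In the splitting one theta graph may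
  exceptionally contribute two whole paths, provided that their union meets \<open>H\<close> in an odd number of
  elements and that \<open>a\<close> is absent. A digraph with two auxiliary vertices for each bunch enforces
  precisely this rule (\<open>routed_by_hub\<close>), so every element splitting of \<open>M\<close> is a gammoid.
\<close>

section \<open>Linkings as matchings\<close>

definition exit_time :: "('v \<Rightarrow> 'v) \<Rightarrow> 'v set \<Rightarrow> 'v \<Rightarrow> nat" where
  "exit_time g A x = (LEAST n. (g ^^ n) x \<notin> A)"

definition exit_point :: "('v \<Rightarrow> 'v) \<Rightarrow> 'v set \<Rightarrow> 'v \<Rightarrow> 'v" where
  "exit_point g A x = (g ^^ exit_time g A x) x"

text \<open>
  Orbits of an injective partial map that start outside its range can be traced back step by step, so
  they neither meet each other nor themselves. This one fact yields both the disjoint paths of a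
  linking and the alternating paths of two matchings.
\<close>

lemma orbits_disjoint:
  assumes inj: "inj_on g A"
    and "x \<notin> g ` A" "y \<notin> g ` A"
    and "\<forall>k<i. (g ^^ k) x \<in> A" "\<forall>k<j. (g ^^ k) y \<in> A"
    and "(g ^^ i) x = (g ^^ j) y"
  shows "i = j \<and> x = y"
  using assms(2-)
proof (induction i arbitrary: j)
  case 0
  show ?case
  proof (cases j)
    case (Suc k)
    then show ?thesis using 0 by auto
  qed (use 0 in auto)
next
  case (Suc i)
  show ?case
  proof (cases j)
    case 0
    then show ?thesis using Suc.prems by auto
  next
    case (Suc k)
    have "(g ^^ i) x = (g ^^ k) y"
      using inj Suc.prems Suc by (auto dest: inj_onD)
    then show ?thesis
      using Suc.IH[of k] Suc.prems Suc by auto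
  qed
qed

lemma orbit_leaves:
  assumes "finite A" "inj_on g A" "x \<notin> g ` A"
  shows "\<exists>n. (g ^^ n) x \<notin> A"
proof (rule ccontr)
  assume "\<not> ?thesis"
  then have all: "(g ^^ n) x \<in> A" for n by simp
  have "inj (\<lambda>n. (g ^^ n) x)"
    using orbits_disjoint[OF assms(2,3,3)] all by (auto intro: injI)
  then have "infinite (range (\<lambda>n. (g ^^ n) x))"
    by (rule range_inj_infinite)
  moreover have "range (\<lambda>n. (g ^^ n) x) \<subseteq> A" using all by auto
  ultimately show False using assms(1) finite_subset by blast
qed

lemma exit_point_notin:
  assumes "finite A" "inj_on g A" "x \<notin> g ` A"
  shows "exit_point g A x \<notin> A"
  unfolding exit_point_def exit_time_def
  using orbit_leaves[OF assms] by (metis (mono_tags, lifting) LeastI_ex)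

lemma before_exit_time: "k < exit_time g A x \<Longrightarrow> (g ^^ k) x \<in> A"
  unfolding exit_time_def using not_less_Least by blast

lemma orbits_disjoint_until_exit:
  assumes "inj_on g A" "x \<notin> g ` A" "y \<notin> g ` A"
    and "i \<le> exit_time g A x" "j \<le> exit_time g A y" "(g ^^ i) x = (g ^^ j) y"
  shows "i = j \<and> x = y"
  using assms(4,5) before_exit_time[of _ g A]
  by (intro orbits_disjoint[OF assms(1-3) _ _ assms(6)]) (meson less_le_trans)+

text \<open>
  The matching behind a linking of \<open>X\<close> into \<open>B\<close>: every vertex outside \<open>B\<close> is sent to its successor on
  the path through it, and a vertex on no path to itself. The starting points \<open>X\<close> are never hit.
  Equivalently, the complement of \<open>X\<close> contains a transversal of the sets \<open>{v} \<union> R `` {v}\<close> with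
  \<open>v \<notin> B\<close>.
\<close>

definition routes :: "'v set \<Rightarrow> 'v rel \<Rightarrow> 'v set \<Rightarrow> 'v set \<Rightarrow> ('v \<Rightarrow> 'v) \<Rightarrow> bool" where
  "routes V R B X f \<longleftrightarrow> inj_on f (V - B) \<and>
     (\<forall>v \<in> V - B. f v \<in> V - X \<and> (f v = v \<or> (v, f v) \<in> R))"

lemma awalk_vertices:
  assumes "fin_digraph D" "pre_digraph.awalk D u p v"
  shows "successively (\<lambda>x y. (x, y) \<in> arcs_ends D) (pre_digraph.awalk_verts D u p) \<and>
    set (pre_digraph.awalk_verts D u p) \<subseteq> verts D \<and>
    hd (pre_digraph.awalk_verts D u p) = u \<and> last (pre_digraph.awalk_verts D u p) = v \<and>
    pre_digraph.awalk_verts D u p \<noteq> []"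
proof -
  interpret fin_digraph D by fact
  show ?thesis using assms(2)
  proof (induction p arbitrary: u)
    case Nil
    then show ?case by (auto simp: awalk_def)
  next
    case (Cons e p)
    then have e: "e \<in> arcs D" "tail D e = u" "awalk (head D e) p v"
      by (auto simp: awalk_def)
    then show ?case using Cons.IH[OF e(3)]
      by (auto simp: successively_Cons arcs_ends_def arc_to_ends_def)
  qed
qed

lemma awalk_through:
  assumes "fin_digraph D" "ws \<noteq> []" "hd ws \<in> verts D"
    "successively (\<lambda>x y. (x, y) \<in> arcs_ends D) ws"
  shows "\<exists>p. pre_digraph.awalk D (hd ws) p (last ws) \<and>
    pre_digraph.awalk_verts D (hd ws) p = ws"
proof -
  interpret fin_digraph D by fact
  show ?thesis using assms(2-)
  proof (induction ws)
    case (Cons x ws)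
    show ?case
    proof (cases "ws = []")
      case True
      then show ?thesis using Cons.prems by (intro exI[of _ "[]"]) (auto simp: awalk_def)
    next
      case False
      then have "(x, hd ws) \<in> arcs_ends D" and succ: "successively (\<lambda>x y. (x, y) \<in> arcs_ends D) ws"
        using Cons.prems by (auto simp: successively_Cons)
      then obtain e where e: "e \<in> arcs D" "tail D e = x" "head D e = hd ws"
        by (auto simp: arcs_ends_def arc_to_ends_def)
      then have "hd ws \<in> verts D" by (metis head_in_verts)
      then obtain p where "awalk (hd ws) p (last ws)" "awalk_verts (hd ws) p = ws"
        using Cons.IH False succ by blast
      then show ?thesis using e False Cons.prems
        by (intro exI[of _ "e # p"]) (auto simp: awalk_def)
    qed
  qed simp
qed

text \<open>
  The injection moves every vertex of a path one step ahead. This is possible for all path vertices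
  outside \<open>B\<close>, since a path ends in \<open>B\<close>. No starting point is hit because paths have no repetitions and
  are disjoint.
\<close>

lemma linked_into_routes:
  assumes D: "fin_digraph D" and "linked_into D X B"
  shows "\<exists>f. routes (verts D) (arcs_ends D) B X f"
proof -
  interpret fin_digraph D by fact
  obtain p t where path: "\<And>x. x \<in> X \<Longrightarrow> apath x (p x) (t x)" "\<And>x. x \<in> X \<Longrightarrow> t x \<in> B"
    and disj: "\<And>x y. x \<in> X \<Longrightarrow> y \<in> X \<Longrightarrow> x \<noteq> y \<Longrightarrow>
      set (awalk_verts x (p x)) \<inter> set (awalk_verts y (p y)) = {}"
    using assms(2) unfolding linked_into_def by blast
  define w where "w x = awalk_verts x (p x)" for x
  have w: "successively (\<lambda>x y. (x, y) \<in> arcs_ends D) (w x)" "set (w x) \<subseteq> verts D"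
    "hd (w x) = x" "last (w x) \<in> B" "w x \<noteq> []" "distinct (w x)" if "x \<in> X" for x
    using awalk_vertices[OF D] path[OF that] unfolding w_def apath_def by auto
  have step: "\<exists>x i. x \<in> X \<and> Suc i < length (w x) \<and> v = w x ! i"
    if v: "v \<in> (\<Union>x\<in>X. set (w x)) - B" for v
  proof -
    obtain x i where xi: "x \<in> X" "i < length (w x)" "v = w x ! i"
      using v by (auto simp: in_set_conv_nth)
    have "Suc i \<noteq> length (w x)"
      using w(4,5)[OF xi(1)] v xi by (metis DiffD2 diff_Suc_1 last_conv_nth)
    then show ?thesis using xi by (metis Suc_lessI)
  qed
  \<comment> \<open>\<open>v\<close> is the vertex number \<open>ix v\<close> of the path that starts in \<open>px v\<close>.\<close>
  then obtain px ix where next_on: "\<And>v. v \<in> (\<Union>x\<in>X. set (w x)) - B \<Longrightarrow>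
      px v \<in> X \<and> Suc (ix v) < length (w (px v)) \<and> v = w (px v) ! ix v"
    by metis
  define f where "f v = (if v \<in> (\<Union>x\<in>X. set (w x)) then w (px v) ! Suc (ix v) else v)" for v
  have same: "x = y \<and> i = j"
    if "x \<in> X" "y \<in> X" "i < length (w x)" "j < length (w y)" "w x ! i = w y ! j" for x y i j
    using that disj[of x y] w(6)[of x] unfolding w_def[symmetric]
    by (metis disjoint_iff nth_eq_iff_index_eq nth_mem)
  have "inj_on f (verts D - B)"
  proof (rule inj_onI)
    fix u v assume uv: "u \<in> verts D - B" "v \<in> verts D - B" "f u = f v"
    have on: "f u \<in> (\<Union>x\<in>X. set (w x)) \<longleftrightarrow> u \<in> (\<Union>x\<in>X. set (w x))"
      if "u \<in> verts D - B" for u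
      using next_on[of u] that unfolding f_def by (auto intro: nth_mem)
    show "u = v"
    proof (cases "u \<in> (\<Union>x\<in>X. set (w x))")
      case True
      then have v: "v \<in> (\<Union>x\<in>X. set (w x))" using on uv by metis
      have "px u = px v \<and> Suc (ix u) = Suc (ix v)"
        using next_on[of u] next_on[of v] True v uv by (intro same) (auto simp: f_def)
      then show ?thesis
        using next_on[of u] next_on[of v] True v uv by (metis DiffD2 DiffI nat.inject)
    next
      case False
      then have "v \<notin> (\<Union>x\<in>X. set (w x))" using on uv by metis
      then show ?thesis using uv(3) False by (simp add: f_def)
    qed
  qed
  moreover have "f v \<in> verts D - X \<and> (f v = v \<or> (v, f v) \<in> arcs_ends D)"
    if v: "v \<in> verts D - B" for v
  proof (cases "v \<in> (\<Union>x\<in>X. set (w x))")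
    case True
    let ?x = "px v" and ?i = "ix v"
    have n: "?x \<in> X" "Suc ?i < length (w ?x)" "w ?x ! ?i = v" using next_on[of v] True v by simp_all
    have fv: "f v = w ?x ! Suc ?i" using True by (simp add: f_def)
    have "f v \<notin> X"
    proof
      assume "f v \<in> X"
      then have "w (f v) ! 0 = f v" "0 < length (w (f v))" using w by (auto simp: hd_conv_nth)
      then show False using same[of ?x "f v" "Suc ?i" 0] n(1,2) fv \<open>f v \<in> X\<close> by (metis nat.distinct(1))
    qed
    moreover have "(v, f v) \<in> arcs_ends D"
      using successively_nth[OF w(1)[OF n(1)] n(2)] n(3) fv by simp
    moreover have "f v \<in> verts D" using w(2)[OF n(1)] n(2) fv by (metis nth_mem subsetD)
    ultimately show ?thesis by blast
  next
    case False
    then have "v \<notin> X" using w(3,5) by (metis UN_iff hd_in_set)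
    then show ?thesis using False v by (simp add: f_def)
  qed
  ultimately show ?thesis unfolding routes_def by blast
qed

text \<open>
  The path of \<open>x \<in> X\<close> is its orbit under the injection up to the first vertex in \<open>B\<close>. A step of such an
  orbit cannot stay put, as orbits do not repeat, so it follows an arc.
\<close>

lemma routes_linked_into:
  assumes D: "fin_digraph D" and X: "X \<subseteq> verts D"
    and f: "routes (verts D) (arcs_ends D) B X f"
  shows "linked_into D X B"
proof -
  interpret fin_digraph D by fact
  let ?A = "verts D - B"
  have inj: "inj_on f ?A" and start: "x \<notin> f ` ?A" if "x \<in> X" for x
    using f that unfolding routes_def by auto
  define w where "w x = map (\<lambda>k. (f ^^ k) x) [0..<Suc (exit_time f ?A x)]" for x
  have fin: "finite ?A" by simp
  have w: "w x \<noteq> []" "hd (w x) = x" "last (w x) = exit_point f ?A x" for x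
    unfolding w_def by (auto simp: hd_map last_map exit_point_def simp del: upt_Suc)
  have in_w: "y \<in> set (w x) \<longleftrightarrow> (\<exists>k \<le> exit_time f ?A x. y = (f ^^ k) x)" for x y
    unfolding w_def by (auto simp: less_Suc_eq_le simp del: upt_Suc)
  have in_verts: "(f ^^ k) x \<in> verts D" if "x \<in> X" "k \<le> exit_time f ?A x" for x k
    using that
  proof (cases k)
    case (Suc j)
    then have "(f ^^ j) x \<in> ?A" using that before_exit_time[of j f ?A x] by simp
    then show ?thesis using f Suc unfolding routes_def by auto
  qed (use X in auto)
  have no_rep: "i = j \<and> x = y" if "x \<in> X" "y \<in> X" "i \<le> exit_time f ?A x" "j \<le> exit_time f ?A y"
    "(f ^^ i) x = (f ^^ j) y" for x y i j
    using orbits_disjoint_until_exit[OF inj start start] that by blast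
  have dist: "distinct (w x)" if "x \<in> X" for x
    unfolding w_def distinct_map using no_rep that by (auto intro!: inj_onI simp del: upt_Suc)
  have succ: "successively (\<lambda>x y. (x, y) \<in> arcs_ends D) (w x)" if "x \<in> X" for x
  proof -
    have "((f ^^ k) x, (f ^^ Suc k) x) \<in> arcs_ends D" if k: "k < exit_time f ?A x" for k
    proof -
      have "(f ^^ k) x \<in> ?A" using k by (rule before_exit_time)
      moreover have "(f ^^ Suc k) x \<noteq> (f ^^ k) x"
        using no_rep[OF \<open>x \<in> X\<close> \<open>x \<in> X\<close>, of "Suc k" k] k by auto
      ultimately show ?thesis using f unfolding routes_def by auto
    qed
    then show ?thesis
      unfolding successively_conv_nth w_def by (auto simp: nth_append simp del: upt_Suc)
  qed
  have "\<exists>p. apath x p (exit_point f ?A x) \<and> awalk_verts x p = w x" if "x \<in> X" for x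
  proof -
    have "hd (w x) \<in> verts D" using w(2) X that by auto
    then show ?thesis
      using awalk_through[OF D w(1) _ succ[OF that]] dist[OF that] w(2,3)[of x]
      unfolding apath_def by metis
  qed
  then obtain p where p: "\<And>x. x \<in> X \<Longrightarrow> apath x (p x) (exit_point f ?A x)"
      "\<And>x. x \<in> X \<Longrightarrow> awalk_verts x (p x) = w x"
    by metis
  have "exit_point f ?A x \<in> B" if "x \<in> X" for x
    using exit_point_notin[OF fin inj start] that in_verts[of x "exit_time f ?A x"]
    unfolding exit_point_def by blast
  moreover have "set (w x) \<inter> set (w y) = {}" if "x \<in> X" "y \<in> X" "x \<noteq> y" for x y
    using no_rep that unfolding disjoint_iff in_w by blast
  ultimately show ?thesis
    unfolding linked_into_def using p by (intro exI[of _ p] exI[of _ "exit_point f ?A"]) auto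
qed

lemma linked_into_iff_routes:
  assumes "fin_digraph D" "X \<subseteq> verts D"
  shows "linked_into D X B \<longleftrightarrow> (\<exists>f. routes (verts D) (arcs_ends D) B X f)"
  using linked_into_routes routes_linked_into assms by blast

section \<open>Gammoids and base orderability\<close>

definition routed_by ::
    "'a pre_matroid \<Rightarrow> 'v set \<Rightarrow> 'v rel \<Rightarrow> 'v set \<Rightarrow> ('a \<Rightarrow> 'v) \<Rightarrow> bool" where
  "routed_by M V R B \<phi> \<longleftrightarrow> finite V \<and> R \<subseteq> V \<times> V \<and> B \<subseteq> V \<and>
     inj_on \<phi> (ground M) \<and> \<phi> ` ground M \<subseteq> V \<and>
     (\<forall>X \<subseteq> ground M. X \<in> indeps M \<longleftrightarrow> (\<exists>f. routes V R B (\<phi> ` X) f))"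

lemma routed_byD:
  assumes "routed_by M V R B \<phi>"
  shows "finite V" "R \<subseteq> V \<times> V" "B \<subseteq> V" "inj_on \<phi> (ground M)" "\<phi> ` ground M \<subseteq> V"
    "\<And>X. X \<subseteq> ground M \<Longrightarrow> X \<in> indeps M \<longleftrightarrow> (\<exists>f. routes V R B (\<phi> ` X) f)"
  using assms unfolding routed_by_def by simp_all

lemma gammoid_iff_routes:
  "gammoid M \<longleftrightarrow> matroid M \<and> (\<exists>(V :: nat set) R B \<phi>. routed_by M V R B \<phi>)"
proof
  assume "gammoid M"
  then obtain D :: "(nat, nat) pre_digraph" and B S \<phi> where m: "matroid M" and D: "fin_digraph D"
    and sub: "B \<subseteq> verts D" "S \<subseteq> verts D"
    and bij: "bij_betw \<phi> (ground M) (verts D \<inter> S)"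
    and ind: "\<And>X. X \<subseteq> ground M \<Longrightarrow>
      X \<in> indeps M \<longleftrightarrow> \<phi> ` X \<in> {I \<in> indeps (strict_gammoid D B). I \<subseteq> S}"
    unfolding gammoid_def matroid_iso_def matroid_restrict_def
    by (auto simp: strict_gammoid_def)
  interpret fin_digraph D by fact
  have \<phi>: "inj_on \<phi> (ground M)" "\<phi> ` ground M = S"
    using bij sub unfolding bij_betw_def by auto
  have arcs: "arcs_ends D \<subseteq> verts D \<times> verts D"
    by (auto simp: arcs_ends_def arc_to_ends_def)
  have "X \<in> indeps M \<longleftrightarrow> (\<exists>f. routes (verts D) (arcs_ends D) B (\<phi> ` X) f)"
    if "X \<subseteq> ground M" for X
  proof -
    have "\<phi> ` X \<subseteq> S" using that \<phi> by auto
    then show ?thesis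
      using ind[OF that] linked_into_iff_routes[OF D, of "\<phi> ` X"] sub
      by (auto simp: strict_gammoid_def)
  qed
  moreover have "\<phi> ` ground M \<subseteq> verts D" using \<phi>(2) sub by simp
  ultimately have "routed_by M (verts D) (arcs_ends D) B \<phi>"
    unfolding routed_by_def using sub(1) \<phi>(1) arcs by simp
  with m show "matroid M \<and> (\<exists>(V :: nat set) R B \<phi>. routed_by M V R B \<phi>)" by blast
next
  assume "matroid M \<and> (\<exists>(V :: nat set) R B \<phi>. routed_by M V R B \<phi>)"
  then obtain V :: "nat set" and R B \<phi> where m: "matroid M" and r: "routed_by M V R B \<phi>" by blast
  note V = routed_byD(1-5)[OF r] and ind = routed_byD(6)[OF r]
  \<comment> \<open>The digraph without parallel arcs whose arcs are coded pairs.\<close>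
  define D where "D = \<lparr>verts = V, arcs = prod_encode ` R,
    tail = fst \<circ> prod_decode, head = snd \<circ> prod_decode\<rparr>"
  have finR: "finite R" using V finite_subset by blast
  have D: "fin_digraph D"
    by unfold_locales (use V finR in \<open>auto simp: D_def\<close>)
  have ends: "arcs_ends D = R"
    unfolding arcs_ends_def arc_to_ends_def D_def by (auto simp: image_image)
  have "X \<in> indeps M \<longleftrightarrow> \<phi> ` X \<in> {I \<in> indeps (strict_gammoid D B). I \<subseteq> \<phi> ` ground M}"
    if "X \<subseteq> ground M" for X
  proof -
    have "\<phi> ` X \<subseteq> \<phi> ` ground M" using that by (rule image_mono)
    moreover from this have "\<phi> ` X \<subseteq> V" using V(5) by (rule subset_trans)
    ultimately show ?thesis
      using ind[OF that] linked_into_iff_routes[OF D, of "\<phi> ` X" B] ends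
      by (auto simp: strict_gammoid_def D_def)
  qed
  moreover have "bij_betw \<phi> (ground M) (verts D \<inter> \<phi> ` ground M)"
    using V unfolding bij_betw_def D_def by auto
  ultimately have "matroid_iso M (matroid_restrict (strict_gammoid D B) (\<phi> ` ground M))"
    unfolding matroid_iso_def matroid_restrict_def
    by (intro exI[of _ \<phi>]) (auto simp: strict_gammoid_def)
  moreover have "B \<subseteq> verts D" "\<phi> ` ground M \<subseteq> verts D" using V by (auto simp: D_def)
  ultimately show "gammoid M" unfolding gammoid_def using m D by blast
qed

lemma routes_image:
  assumes j: "inj_on j V" and R: "R \<subseteq> V \<times> V" and "B \<subseteq> V" "X \<subseteq> V"
  shows "(\<exists>f. routes (j ` V) (map_prod j j ` R) (j ` B) (j ` X) f) \<longleftrightarrow> (\<exists>f. routes V R B X f)"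
proof
  have diff: "j ` V - j ` B = j ` (V - B)" "j ` V - j ` X = j ` (V - X)"
    using assms by (auto simp: inj_on_image_set_diff)
  have arc: "(j u, j v) \<in> map_prod j j ` R \<longleftrightarrow> (u, v) \<in> R" if "u \<in> V" "v \<in> V" for u v
    using that j R by (auto simp: inj_on_eq_iff)
  {
    assume "\<exists>f. routes (j ` V) (map_prod j j ` R) (j ` B) (j ` X) f"
    then obtain f where f: "inj_on f (j ` (V - B))"
      "\<And>v. v \<in> V - B \<Longrightarrow> f (j v) \<in> j ` (V - X) \<and> (f (j v) = j v \<or> (j v, f (j v)) \<in> map_prod j j ` R)"
      unfolding routes_def diff by blast
    define g where "g = inv_into V j \<circ> f \<circ> j"
    have g: "g v \<in> V - X" "j (g v) = f (j v)" if v: "v \<in> V - B" for v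
    proof -
      obtain w where "w \<in> V - X" "f (j v) = j w" using f(2)[OF v] by blast
      then show "g v \<in> V - X" "j (g v) = f (j v)"
        using inv_into_f_f[OF j, of w] unfolding g_def by auto
    qed
    have "inj_on g (V - B)"
    proof (rule inj_onI)
      fix u v assume uv: "u \<in> V - B" "v \<in> V - B" "g u = g v"
      then have "f (j u) = f (j v)" using g(2) by metis
      then have "j u = j v" using f(1) uv by (auto dest: inj_onD)
      then show "u = v" using j uv by (auto dest: inj_onD)
    qed
    moreover have "g v = v \<or> (v, g v) \<in> R" if "v \<in> V - B" for v
      using f(2)[OF that] g[OF that] arc[of v "g v"] that j by (metis DiffD1 inj_onD)
    ultimately show "\<exists>f. routes V R B X f"
      unfolding routes_def using g(1) by blast
  }
  {
    assume "\<exists>f. routes V R B X f"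
    then obtain f where f: "inj_on f (V - B)"
      "\<And>v. v \<in> V - B \<Longrightarrow> f v \<in> V - X \<and> (f v = v \<or> (v, f v) \<in> R)"
      unfolding routes_def by blast
    define g where "g = j \<circ> f \<circ> inv_into V j"
    have g: "g (j v) = j (f v)" if "v \<in> V - B" for v
      using that j unfolding g_def by auto
    have "inj_on g (j ` (V - B))"
    proof (rule inj_onI)
      fix x y assume "x \<in> j ` (V - B)" "y \<in> j ` (V - B)" "g x = g y"
      then obtain u v where uv: "x = j u" "y = j v" "u \<in> V - B" "v \<in> V - B" "j (f u) = j (f v)"
        using g by auto
      then have "f u = f v" using f(2) j by (meson DiffD1 inj_onD)
      then show "x = y" using f(1) uv by (metis inj_onD)
    qed
    moreover have "g x \<in> j ` (V - X) \<and> (g x = x \<or> (x, g x) \<in> map_prod j j ` R)"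
      if x: "x \<in> j ` (V - B)" for x
    proof -
      obtain v where v: "x = j v" "v \<in> V - B" using x by blast
      then show ?thesis using f(2)[OF v(2)] g[OF v(2)] arc[of v "f v"] by auto
    qed
    ultimately show "\<exists>f. routes (j ` V) (map_prod j j ` R) (j ` B) (j ` X) f"
      unfolding routes_def diff by blast
  }
qed

text \<open>
  The digraph of a gammoid may have vertices of an arbitrary type: finitely many vertices can be
  renamed by natural numbers.
\<close>

lemma gammoidI:
  fixes V :: "'v set"
  assumes m: "matroid M" and r: "routed_by M V R B \<phi>"
  shows "gammoid M"
proof -
  note V = routed_byD(1-3)[OF r] and \<phi> = routed_byD(4,5)[OF r] and ind = routed_byD(6)[OF r]
  obtain j :: "'v \<Rightarrow> nat" where j: "inj_on j V"
    using finite_imp_inj_to_nat_seg[OF V(1)] by auto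
  have "inj_on (j \<circ> \<phi>) (ground M)"
    using \<phi> j by (meson comp_inj_on inj_on_subset)
  moreover have "X \<in> indeps M \<longleftrightarrow>
      (\<exists>f. routes (j ` V) (map_prod j j ` R) (j ` B) ((j \<circ> \<phi>) ` X) f)" if "X \<subseteq> ground M" for X
  proof -
    have "\<phi> ` X \<subseteq> V" using image_mono[OF that, of \<phi>] \<phi>(2) by (rule subset_trans)
    then show ?thesis
      using ind[OF that] routes_image[OF j V(2,3), of "\<phi> ` X"] by (simp add: image_comp)
  qed
  moreover have "map_prod j j ` R \<subseteq> j ` V \<times> j ` V" "(j \<circ> \<phi>) ` ground M \<subseteq> j ` V" "j ` B \<subseteq> j ` V"
    using V \<phi>(2) by auto
  ultimately have "routed_by M (j ` V) (map_prod j j ` R) (j ` B) (j \<circ> \<phi>)"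
    unfolding routed_by_def using V(1) by simp
  then show ?thesis unfolding gammoid_iff_routes using m by blast
qed

text \<open>
  Superpose the two matchings. A vertex \<open>z\<close> hit by the second matching but not by the first starts an
  alternating path, whose vertices on the right are the orbit of \<open>z\<close> under \<open>f1 \<circ> f2\<inverse>\<close>; it ends in a
  vertex \<open>\<psi> z\<close> hit by the first matching but not by the second. Swapping the matchings along this path
  exchanges \<open>z\<close> and \<open>\<psi> z\<close> between their ranges. Distinct \<open>z\<close> have disjoint paths, so \<open>\<psi>\<close> is injective.
\<close>

lemma routes_exchange:
  fixes V :: "'v set"
  assumes V: "finite V" and f1: "routes V R B X1 f1" and f2: "routes V R B X2 f2"
  obtains \<psi> where
    "inj_on \<psi> (f2 ` (V - B) - f1 ` (V - B))"
    "\<And>z. z \<in> f2 ` (V - B) - f1 ` (V - B) \<Longrightarrow> \<psi> z \<in> f1 ` (V - B) - f2 ` (V - B) \<and>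
      (\<exists>f. routes V R B (V - insert z (f1 ` (V - B) - {\<psi> z})) f) \<and>
      (\<exists>f. routes V R B (V - insert (\<psi> z) (f2 ` (V - B) - {z})) f)"
proof -
  define L where "L = V - B"
  define A where "A = f2 ` L"
  define g where "g = f1 \<circ> inv_into L f2"
  have f: "inj_on f1 L" "inj_on f2 L"
    "\<And>v. v \<in> L \<Longrightarrow> f1 v \<in> V \<and> (f1 v = v \<or> (v, f1 v) \<in> R)"
    "\<And>v. v \<in> L \<Longrightarrow> f2 v \<in> V \<and> (f2 v = v \<or> (v, f2 v) \<in> R)"
    using f1 f2 unfolding routes_def L_def by auto
  have finA: "finite A" unfolding A_def L_def using V by simp
  have gf2: "g (f2 v) = f1 v" if "v \<in> L" for v
    using f(2) that unfolding g_def by simp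
  have gA: "g ` A = f1 ` L" unfolding A_def using gf2 by force
  have injg: "inj_on g A"
    unfolding g_def A_def using f(1,2)
    by (intro comp_inj_on inj_on_inv_into) auto
  define Z where "Z = f2 ` L - f1 ` L"
  have start: "z \<notin> g ` A" if "z \<in> Z" for z using that gA unfolding Z_def by simp
  \<comment> \<open>the right vertices of the alternating path from \<open>z\<close>, except for its end\<close>
  define orb where "orb z = {(g ^^ k) z | k. k < exit_time g A z}" for z
  have orbA: "orb z \<subseteq> A" for z
    unfolding orb_def using before_exit_time by fastforce
  let ?\<psi> = "exit_point g A"
  have pos: "0 < exit_time g A z" if "z \<in> Z" for z
  proof (rule ccontr)
    assume "\<not> 0 < exit_time g A z"
    then have "z \<notin> A" using exit_point_notin[OF finA injg start[OF that]] by (simp add: exit_point_def)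
    then show False using that unfolding Z_def A_def by blast
  qed
  have g_orb: "insert z (g ` orb z) = insert (?\<psi> z) (orb z)" "?\<psi> z \<in> g ` orb z" "z \<in> orb z" if z: "z \<in> Z" for z
  proof -
    have st: "g ` orb z = {(g ^^ k) z | k. 0 < k \<and> k \<le> exit_time g A z}"
    proof (intro subset_antisym subsetI)
      fix y assume "y \<in> g ` orb z"
      then obtain k where "k < exit_time g A z" "y = (g ^^ Suc k) z" unfolding orb_def by auto
      then show "y \<in> {(g ^^ k) z | k. 0 < k \<and> k \<le> exit_time g A z}"
        using Suc_leI by blast
    next
      fix y assume "y \<in> {(g ^^ k) z | k. 0 < k \<and> k \<le> exit_time g A z}"
      then obtain k where "k < exit_time g A z" "y = (g ^^ Suc k) z"
        by (auto simp del: funpow.simps) (metis Suc_le_lessD gr0_conv_Suc)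
      then show "y \<in> g ` orb z" unfolding orb_def by auto
    qed
    show "insert z (g ` orb z) = insert (?\<psi> z) (orb z)"
    proof (intro subset_antisym subsetI)
      fix y assume "y \<in> insert z (g ` orb z)"
      then have "\<exists>k. k \<le> exit_time g A z \<and> y = (g ^^ k) z"
        unfolding st by (auto intro: exI[of _ 0])
      then obtain k where "k \<le> exit_time g A z" "y = (g ^^ k) z" by blast
      then show "y \<in> insert (?\<psi> z) (orb z)"
        unfolding orb_def exit_point_def by (cases "k = exit_time g A z") auto
    next
      fix y assume "y \<in> insert (?\<psi> z) (orb z)"
      then have "\<exists>k. k \<le> exit_time g A z \<and> y = (g ^^ k) z"
        unfolding orb_def exit_point_def by (auto intro: less_imp_le)
      then obtain k where "k \<le> exit_time g A z" "y = (g ^^ k) z" by blast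
      then show "y \<in> insert z (g ` orb z)"
        unfolding st by (cases "k = 0") auto
    qed
    show "?\<psi> z \<in> g ` orb z" unfolding st exit_point_def using pos[OF z] by blast
    show "z \<in> orb z" unfolding orb_def using pos[OF z] by force
  qed
  have z_notin: "z \<notin> g ` orb z" if "z \<in> Z" for z
    using start[OF that] orbA[of z] by blast
  have \<psi>A: "?\<psi> z \<notin> A" if "z \<in> Z" for z
    using exit_point_notin[OF finA injg start[OF that]] .
  have inj\<psi>: "inj_on ?\<psi> Z"
    unfolding exit_point_def
    by (rule inj_onI) (use orbits_disjoint_until_exit[OF injg start start] in blast)
  have "?\<psi> z \<in> f1 ` L - f2 ` L \<and>
      (\<exists>f. routes V R B (V - insert z (f1 ` L - {?\<psi> z})) f) \<and>
      (\<exists>f. routes V R B (V - insert (?\<psi> z) (f2 ` L - {z})) f)" if z: "z \<in> Z" for z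
  proof -
    \<comment> \<open>the left vertices of the alternating path\<close>
    define O' where "O' = {v \<in> L. f2 v \<in> orb z}"
    have f2O: "f2 ` O' = orb z" unfolding O'_def using orbA[of z] unfolding A_def by auto
    have f1O: "f1 ` O' = g ` orb z" unfolding f2O[symmetric] image_image using gf2 unfolding O'_def by auto
    have O'L: "O' \<subseteq> L" unfolding O'_def by auto
    have rest1: "f1 ` (L - O') = f1 ` L - g ` orb z"
      unfolding f1O[symmetric] using f(1) O'L by (simp add: inj_on_image_set_diff)
    have rest2: "f2 ` (L - O') = f2 ` L - orb z"
      unfolding f2O[symmetric] using f(2) O'L by (simp add: inj_on_image_set_diff)
    have routes_if: "\<exists>f. routes V R B (V - Y) f"
      if img: "p ` O' \<union> q ` (L - O') = Y" "p ` O' \<inter> q ` (L - O') = {}"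
        and inj: "inj_on p L" "inj_on q L"
        and ok: "\<And>v. v \<in> L \<Longrightarrow> p v \<in> V \<and> (p v = v \<or> (v, p v) \<in> R)"
          "\<And>v. v \<in> L \<Longrightarrow> q v \<in> V \<and> (q v = v \<or> (v, q v) \<in> R)" for p q Y
    proof -
      define h where "h v = (if v \<in> O' then p v else q v)" for v
      have "inj_on h (O' \<union> (L - O'))"
        unfolding inj_on_Un
      proof (intro conjI)
        show "inj_on h O'" using inj(1) O'L unfolding h_def by (auto simp: inj_on_def)
        show "inj_on h (L - O')" using inj(2) unfolding h_def by (auto simp: inj_on_def)
        show "h ` (O' - (L - O')) \<inter> h ` (L - O' - O') = {}"
          using img(2) unfolding h_def by auto
      qed
      moreover have "O' \<union> (L - O') = L" using O'L by blast
      moreover have "h v \<in> Y" if "v \<in> L" for v using that img(1) unfolding h_def by auto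
      ultimately show ?thesis
        unfolding routes_def L_def[symmetric] using ok by (intro exI[of _ h]) (auto simp: h_def)
    qed
    have avoid: "P \<inter> (S - Q) = {}" if "P \<subseteq> insert y Q" "y \<notin> S" for P Q S and y :: 'v
      using that by blast
    have \<psi>z: "?\<psi> z \<in> f1 ` L - f2 ` L"
      using g_orb(2)[OF z] orbA[of z] gA \<psi>A[OF z] unfolding A_def by blast
    moreover have "\<exists>f. routes V R B (V - insert z (f1 ` L - {?\<psi> z})) f"
    proof (rule routes_if[of f2 f1])
      have sub: "g ` orb z \<subseteq> f1 ` L" using orbA[of z] gA by blast
      have notorb: "?\<psi> z \<notin> orb z" using \<psi>A[OF z] orbA by blast
      show "f2 ` O' \<union> f1 ` (L - O') = insert z (f1 ` L - {?\<psi> z})"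
        unfolding f2O rest1 using g_orb[OF z] sub notorb by blast
      show "f2 ` O' \<inter> f1 ` (L - O') = {}"
      proof -
        have "orb z \<subseteq> insert z (g ` orb z)" using g_orb(1)[OF z] by (metis subset_insertI)
        moreover have "z \<notin> f1 ` L" using z unfolding Z_def by simp
        ultimately show ?thesis unfolding f2O rest1 by (rule avoid)
      qed
    qed (use f in auto)
    moreover have "\<exists>f. routes V R B (V - insert (?\<psi> z) (f2 ` L - {z})) f"
    proof (rule routes_if[of f1 f2])
      have sub: "orb z \<subseteq> f2 ` L" using orbA[of z] unfolding A_def .
      show "f1 ` O' \<union> f2 ` (L - O') = insert (?\<psi> z) (f2 ` L - {z})"
        unfolding f1O rest2 using g_orb[OF z] sub z_notin[OF z] by blast
      show "f1 ` O' \<inter> f2 ` (L - O') = {}"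
      proof -
        have "g ` orb z \<subseteq> insert (?\<psi> z) (orb z)" using g_orb(1)[OF z] by (metis subset_insertI)
        moreover have "?\<psi> z \<notin> f2 ` L" using \<psi>z by simp
        ultimately show ?thesis unfolding f1O rest2 by (rule avoid)
      qed
    qed (use f in auto)
    ultimately show ?thesis by blast
  qed
  then show thesis using that[of ?\<psi>] inj\<psi> unfolding Z_def L_def by blast
qed

lemma routes_antimono: "routes V R B X f \<Longrightarrow> Y \<subseteq> X \<Longrightarrow> routes V R B Y f"
  unfolding routes_def by blast

text \<open>
  Base orderability of gammoids, stated for independent sets. The hypothesis says that \<open>B2\<close> is maximal
  as far as the elements of \<open>B1\<close> are concerned. It makes the ends of the alternating paths lie in
  \<open>B2\<close>: otherwise swapping along the path would leave \<open>B2\<close> untouched and add \<open>z\<close> to it.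
\<close>

lemma gammoid_exchange:
  assumes M: "gammoid M" and B1: "B1 \<in> indeps M" and B2: "B2 \<in> indeps M"
    and dep: "\<And>z. z \<in> B1 - B2 \<Longrightarrow> insert z B2 \<notin> indeps M"
  obtains \<psi> where "inj_on \<psi> (B1 - B2)"
    "\<And>z. z \<in> B1 - B2 \<Longrightarrow> \<psi> z \<in> B2 - B1 \<and> insert (\<psi> z) (B1 - {z}) \<in> indeps M \<and>
      insert z (B2 - {\<psi> z}) \<in> indeps M"
proof -
  interpret matroid M using M unfolding gammoid_def by blast
  obtain V :: "nat set" and R B \<phi> where r: "routed_by M V R B \<phi>"
    using M unfolding gammoid_iff_routes by blast
  note V = routed_byD(1-3)[OF r] and \<phi> = routed_byD(4,5)[OF r] and ind = routed_byD(6)[OF r]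
  have sub: "B1 \<subseteq> ground M" "B2 \<subseteq> ground M" using indeps_subset_ground B1 B2 by auto
  obtain f1 f2 where f: "routes V R B (\<phi> ` B1) f1" "routes V R B (\<phi> ` B2) f2"
    using ind[OF sub(1)] ind[OF sub(2)] B1 B2 by auto
  let ?L = "V - B"
  let ?Z = "f2 ` ?L - f1 ` ?L"
  have im: "f1 ` ?L \<subseteq> V - \<phi> ` B1" "f2 ` ?L \<subseteq> V - \<phi> ` B2" using f unfolding routes_def by auto
  obtain \<psi> where \<psi>: "inj_on \<psi> ?Z"
    "\<And>z. z \<in> ?Z \<Longrightarrow> \<psi> z \<in> f1 ` ?L - f2 ` ?L \<and>
      (\<exists>f. routes V R B (V - insert z (f1 ` ?L - {\<psi> z})) f) \<and>
      (\<exists>f. routes V R B (V - insert (\<psi> z) (f2 ` ?L - {z})) f)"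
    using routes_exchange[OF V(1) f] by metis
  have inZ: "\<phi> z \<in> ?Z" if z: "z \<in> B1 - B2" for z
  proof -
    have "\<phi> z \<in> f2 ` ?L"
    proof (rule ccontr)
      assume "\<phi> z \<notin> f2 ` ?L"
      then have "f2 v \<noteq> \<phi> z" if "v \<in> V - B" for v using that by (metis imageI)
      then have "routes V R B (\<phi> ` insert z B2) f2"
        using f(2) unfolding routes_def by auto
      then show False using dep[OF z] ind[of "insert z B2"] z sub by blast
    qed
    then show ?thesis using im(1) z by blast
  qed
  have step: "\<exists>y \<in> B2 - B1. \<psi> (\<phi> z) = \<phi> y \<and> insert y (B1 - {z}) \<in> indeps M \<and>
      insert z (B2 - {y}) \<in> indeps M" if z: "z \<in> B1 - B2" for z
  proof -
    let ?p = "\<psi> (\<phi> z)"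
    have p: "?p \<in> f1 ` ?L" "?p \<notin> f2 ` ?L" using \<psi>(2)[OF inZ[OF z]] by auto
    obtain h1 h2 where h: "routes V R B (V - insert (\<phi> z) (f1 ` ?L - {?p})) h1"
      "routes V R B (V - insert ?p (f2 ` ?L - {\<phi> z})) h2"
      using \<psi>(2)[OF inZ[OF z]] by blast
    have gz: "z \<in> ground M" using z sub by blast
    have eq: "x = y" if "\<phi> x = \<phi> y" "x \<in> ground M" "y \<in> ground M" for x y
      using that \<phi>(1) by (auto dest: inj_onD)
    have inV: "\<phi> x \<in> V" if "x \<in> ground M" for x using that \<phi>(2) by blast
    have not_im: "\<phi> x \<notin> f1 ` ?L" if "x \<in> B1" for x using that im(1) by blast
    have not_im2: "\<phi> x \<notin> f2 ` ?L" if "x \<in> B2" for x using that im(2) by blast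
    have "?p \<in> \<phi> ` B2"
    proof (rule ccontr)
      assume no: "?p \<notin> \<phi> ` B2"
      have "\<phi> x \<in> V - insert ?p (f2 ` ?L - {\<phi> z})" if "x \<in> insert z B2" for x
      proof (cases "x = z")
        case True
        have "?p \<noteq> \<phi> z" using inZ[OF z] p(2) by (metis DiffD1)
        then show ?thesis unfolding True using inV[OF gz] by simp
      next
        case False
        then have "x \<in> B2" using that by simp
        then have "\<phi> x \<in> V" "\<phi> x \<notin> f2 ` ?L" "\<phi> x \<noteq> ?p"
          using inV sub not_im2 no by (auto simp: image_iff)
        then show ?thesis by simp
      qed
      then have "routes V R B (\<phi> ` insert z B2) h2"
        by (intro routes_antimono[OF h(2)] image_subsetI)
      then have "insert z B2 \<in> indeps M"
        using ind[of "insert z B2"] sub gz by blast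
      then show False using dep[OF z] by blast
    qed
    then obtain y where y: "y \<in> B2" "?p = \<phi> y" by blast
    have yB1: "y \<notin> B1" using p(1) not_im[of y] y by auto
    have gy: "y \<in> ground M" using y sub by blast
    have "\<phi> x \<in> V - insert (\<phi> z) (f1 ` ?L - {?p})" if "x \<in> insert y (B1 - {z})" for x
    proof (cases "x = y")
      case True
      have "\<phi> y \<noteq> \<phi> z" using eq[OF _ gy gz] yB1 z by blast
      then show ?thesis unfolding True using inV[OF gy] y(2) by simp
    next
      case False
      then have "x \<in> B1" "x \<noteq> z" using that by auto
      then have "\<phi> x \<in> V" "\<phi> x \<notin> f1 ` ?L" "\<phi> x \<noteq> \<phi> z"
        using inV not_im eq[OF _ _ gz, of x] sub by blast+
      then show ?thesis by simp
    qed
    then have "routes V R B (\<phi> ` insert y (B1 - {z})) h1"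
      by (intro routes_antimono[OF h(1)] image_subsetI)
    then have "insert y (B1 - {z}) \<in> indeps M"
      using ind[of "insert y (B1 - {z})"] sub y by blast
    moreover have "\<phi> x \<in> V - insert ?p (f2 ` ?L - {\<phi> z})" if "x \<in> insert z (B2 - {y})" for x
    proof (cases "x = z")
      case True
      have "\<phi> y \<noteq> \<phi> z" using eq[OF _ gy gz] yB1 z by blast
      then show ?thesis unfolding True using inV[OF gz] y(2) by simp
    next
      case False
      then have "x \<in> B2" "x \<noteq> y" using that by auto
      then have "\<phi> x \<in> V" "\<phi> x \<notin> f2 ` ?L" "\<phi> x \<noteq> \<phi> y"
        using inV not_im2 eq[OF _ _ gy, of x] sub by blast+
      then show ?thesis using y(2) by simp
    qed
    then have "routes V R B (\<phi> ` insert z (B2 - {y})) h2"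
      by (intro routes_antimono[OF h(2)] image_subsetI)
    then have "insert z (B2 - {y}) \<in> indeps M"
      using ind[of "insert z (B2 - {y})"] sub gz by blast
    ultimately show ?thesis using y yB1 by blast
  qed
  then obtain \<chi> where \<chi>: "\<And>z. z \<in> B1 - B2 \<Longrightarrow> \<chi> z \<in> B2 - B1 \<and> \<psi> (\<phi> z) = \<phi> (\<chi> z) \<and>
      insert (\<chi> z) (B1 - {z}) \<in> indeps M \<and> insert z (B2 - {\<chi> z}) \<in> indeps M"
    by metis
  have "inj_on \<chi> (B1 - B2)"
  proof (rule inj_onI)
    fix x y assume xy: "x \<in> B1 - B2" "y \<in> B1 - B2" "\<chi> x = \<chi> y"
    then have "\<psi> (\<phi> x) = \<psi> (\<phi> y)" using \<chi> by metis
    then have "\<phi> x = \<phi> y" by (rule inj_onD[OF \<psi>(1) _ inZ[OF xy(1)] inZ[OF xy(2)]])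
    then show "x = y" by (rule inj_onD[OF \<phi>(1)]) (use xy sub in auto)
  qed
  then show thesis by (rule that) (use \<chi> in blast)
qed

section \<open>Cycle spaces over GF(2)\<close>

lemma odd_card_sym_diff:
  assumes "finite A" "finite B"
  shows "odd (card (sym_diff A B)) \<longleftrightarrow> odd (card A) \<noteq> odd (card B)"
proof -
  have "card (sym_diff A B) = card (A - B) + card (B - A)"
    using assms by (intro card_Un_disjoint) auto
  moreover have "card A = card (A - B) + card (A \<inter> B)" "card B = card (B - A) + card (A \<inter> B)"
    using assms card_Int_Diff[of A B] card_Int_Diff[of B A] by (simp_all add: Int_commute)
  ultimately show ?thesis by presburger
qed

definition odd_count :: "('i \<Rightarrow> bool) \<Rightarrow> 'i set \<Rightarrow> bool" where
  "odd_count P T \<longleftrightarrow> odd (card {t \<in> T. P t})"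

lemma odd_count_empty [simp]: "\<not> odd_count P {}"
  by (simp add: odd_count_def)

lemma odd_count_insert [simp]:
  assumes "finite T" "e \<notin> T"
  shows "odd_count P (insert e T) \<longleftrightarrow> P e \<noteq> odd_count P T"
proof -
  have "{t \<in> insert e T. P t} = (if P e then insert e {t \<in> T. P t} else {t \<in> T. P t})" by auto
  then show ?thesis unfolding odd_count_def using assms by auto
qed

lemma odd_count_single:
  assumes "e \<in> T" "\<And>t. t \<in> T \<Longrightarrow> P t \<longleftrightarrow> t = e"
  shows "odd_count P T"
proof -
  have "{t \<in> T. P t} = {e}" using assms by auto
  then show ?thesis unfolding odd_count_def by simp
qed

text \<open>
  The sum over GF(2) of the sets \<open>C e\<close> with \<open>e \<in> T\<close>.
\<close>

definition cyc_comb :: "('i \<Rightarrow> 'a set) \<Rightarrow> 'i set \<Rightarrow> 'a set" where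
  "cyc_comb C T = {x. odd_count (\<lambda>e. x \<in> C e) T}"

lemma cyc_comb_empty [simp]: "cyc_comb C {} = {}"
  by (simp add: cyc_comb_def)

lemma cyc_comb_insert:
  assumes "finite T" "e \<notin> T"
  shows "cyc_comb C (insert e T) = sym_diff (C e) (cyc_comb C T)"
  unfolding cyc_comb_def using assms by auto

lemma cyc_comb_subset: "cyc_comb C T \<subseteq> (\<Union>e\<in>T. C e)"
proof
  fix x assume "x \<in> cyc_comb C T"
  then have "{e \<in> T. x \<in> C e} \<noteq> {}" unfolding cyc_comb_def odd_count_def by (auto simp del: Collect_empty_eq)
  then show "x \<in> (\<Union>e\<in>T. C e)" by blast
qed

lemma mem_cyc_comb_single:
  assumes "\<And>f. f \<in> T \<Longrightarrow> x \<in> C f \<longleftrightarrow> f = x"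
  shows "x \<in> cyc_comb C T \<longleftrightarrow> x \<in> T"
proof -
  have "{f \<in> T. x \<in> C f} = (if x \<in> T then {x} else {})" using assms by auto
  then show ?thesis unfolding cyc_comb_def odd_count_def by simp
qed

lemma odd_card_cyc_comb:
  assumes "finite T" "\<And>e. e \<in> T \<Longrightarrow> finite (C e)"
  shows "odd (card (cyc_comb C T \<inter> H)) \<longleftrightarrow> odd_count (\<lambda>e. odd (card (C e \<inter> H))) T"
  using assms
proof (induction T)
  case (insert e T)
  have "finite (cyc_comb C T)"
    by (rule finite_subset[OF cyc_comb_subset]) (use insert in auto)
  moreover have "sym_diff (C e) (cyc_comb C T) \<inter> H = sym_diff (C e \<inter> H) (cyc_comb C T \<inter> H)" by blast
  ultimately show ?case using insert by (simp add: cyc_comb_insert odd_card_sym_diff)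
qed simp

text \<open>
  Linear subspaces of the GF(2) vector space of all subsets of \<open>E\<close>, with symmetric difference as
  addition. Their members are the cycles of a binary matroid, that is, the disjoint unions of
  circuits.
\<close>

locale cycle_space =
  fixes E :: "'a set" and Z :: "'a set set"
  assumes finite_E: "finite E"
    and cycle_subset: "S \<in> Z \<Longrightarrow> S \<subseteq> E"
    and empty_cycle: "{} \<in> Z"
    and sym_diff_cycle: "S \<in> Z \<Longrightarrow> T \<in> Z \<Longrightarrow> sym_diff S T \<in> Z"

definition cycle_free :: "'a set set \<Rightarrow> 'a set \<Rightarrow> bool" where
  "cycle_free Z I \<longleftrightarrow> (\<forall>S \<in> Z. S \<subseteq> I \<longrightarrow> S = {})"

definition space_matroid :: "'a set \<Rightarrow> 'a set set \<Rightarrow> 'a pre_matroid" where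
  "space_matroid E Z = \<lparr>ground = E, indeps = {I. I \<subseteq> E \<and> cycle_free Z I}\<rparr>"

lemma space_matroid_simps [simp]:
  "ground (space_matroid E Z) = E"
  "I \<in> indeps (space_matroid E Z) \<longleftrightarrow> I \<subseteq> E \<and> cycle_free Z I"
  by (simp_all add: space_matroid_def)

lemma cycle_free_subset: "cycle_free Z I \<Longrightarrow> J \<subseteq> I \<Longrightarrow> cycle_free Z J"
  unfolding cycle_free_def by blast

lemma new_cycle:
  assumes "cycle_free Z I" "\<not> cycle_free Z (insert e I)"
  shows "\<exists>C \<in> Z. C \<subseteq> insert e I \<and> e \<in> C"
  using assms unfolding cycle_free_def by (metis subset_insert)

context cycle_space
begin

lemma finite_cycle: "S \<in> Z \<Longrightarrow> finite S"
  using finite_subset[OF cycle_subset finite_E] .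

lemma cyc_comb_cycle:
  assumes "finite T" "\<And>e. e \<in> T \<Longrightarrow> C e \<in> Z"
  shows "cyc_comb C T \<in> Z"
  using assms by (induction T) (auto simp: cyc_comb_insert empty_cycle intro: sym_diff_cycle)

text \<open>
  The unique expansion of a cycle in fundamental circuits: the difference of both sides is a cycle
  inside the independent set \<open>I\<close>.
\<close>

lemma eq_comb_of_new_cycles:
  assumes S: "S \<in> Z" and I: "cycle_free Z I" and T: "T \<subseteq> S" "T \<inter> I = {}" "S \<subseteq> T \<union> I"
    and C: "\<And>e. e \<in> T \<Longrightarrow> C e \<in> Z \<and> e \<in> C e \<and> C e \<subseteq> insert e I"
  shows "S = cyc_comb C T"
proof -
  have fin: "finite T" using T(1) finite_cycle[OF S] by (rule finite_subset)
  let ?U = "sym_diff S (cyc_comb C T)"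
  have "?U \<in> Z" using S cyc_comb_cycle[OF fin] C by (intro sym_diff_cycle) blast+
  moreover have "?U \<subseteq> I"
  proof
    fix x assume x: "x \<in> ?U"
    have "x \<notin> T"
    proof
      assume "x \<in> T"
      then have "x \<in> cyc_comb C T"
        using C T(2) by (subst mem_cyc_comb_single) blast+
      then show False using x \<open>x \<in> T\<close> T(1) by blast
    qed
    moreover have "cyc_comb C T \<subseteq> T \<union> I" using cyc_comb_subset[of C T] C by blast
    ultimately show "x \<in> I" using x T(3) by blast
  qed
  ultimately show ?thesis using I unfolding cycle_free_def by blast
qed

text \<open>
  If no element of \<open>J - I\<close> can be added to \<open>I\<close>, each \<open>e \<in> J - I\<close> has a fundamental circuit with respect to
  \<open>I\<close>. Sums of these circuits over distinct subsets of \<open>J - I\<close> have distinct traces on \<open>I - J\<close>, since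
  otherwise their difference would be a nonempty cycle inside \<open>J\<close>. Counting subsets gives
  \<open>2 ^ |J - I| \<le> 2 ^ |I - J|\<close>.
\<close>

lemma card_le_if_no_augment:
  assumes I: "I \<subseteq> E" "cycle_free Z I" and J: "J \<subseteq> E" "cycle_free Z J"
    and no: "\<And>e. e \<in> J - I \<Longrightarrow> \<not> cycle_free Z (insert e I)"
  shows "card J \<le> card I"
proof -
  have fin: "finite I" "finite J" using I(1) J(1) finite_E finite_subset by auto
  obtain C where C: "\<And>e. e \<in> J - I \<Longrightarrow> C e \<in> Z \<and> C e \<subseteq> insert e I \<and> e \<in> C e"
    using new_cycle[OF I(2) no] by metis
  have trace: "cyc_comb C T \<inter> (J - I) = T" "cyc_comb C T \<subseteq> T \<union> I" "cyc_comb C T \<in> Z"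
    if T: "T \<subseteq> J - I" for T
  proof -
    have finT: "finite T" using T fin finite_subset by blast
    show sub: "cyc_comb C T \<subseteq> T \<union> I" using cyc_comb_subset[of C T] C T by blast
    have "x \<in> cyc_comb C T \<longleftrightarrow> x \<in> T" if "x \<in> J - I" for x
      by (rule mem_cyc_comb_single) (use that C T in blast)
    then show "cyc_comb C T \<inter> (J - I) = T" using T by blast
    show "cyc_comb C T \<in> Z" using C T by (intro cyc_comb_cycle finT) blast
  qed
  have "inj_on (\<lambda>T. cyc_comb C T \<inter> (I - J)) (Pow (J - I))"
  proof (rule inj_onI)
    fix T U assume TU: "T \<in> Pow (J - I)" "U \<in> Pow (J - I)"
      "cyc_comb C T \<inter> (I - J) = cyc_comb C U \<inter> (I - J)"
    let ?S = "sym_diff (cyc_comb C T) (cyc_comb C U)"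
    have "?S \<in> Z" using trace(3) TU by (intro sym_diff_cycle) auto
    moreover have "?S \<subseteq> J" using TU trace(2)[of T] trace(2)[of U] by blast
    ultimately have "?S = {}" using J(2) unfolding cycle_free_def by blast
    then have "cyc_comb C T = cyc_comb C U" by blast
    then show "T = U" using trace(1)[of T] trace(1)[of U] TU by blast
  qed
  then have "card (Pow (J - I)) \<le> card (Pow (I - J))"
    using fin by (intro card_inj_on_le) auto
  then have "card (J - I) \<le> card (I - J)"
    using fin by (simp add: card_Pow)
  moreover have "card J = card (J \<inter> I) + card (J - I)" "card I = card (I \<inter> J) + card (I - J)"
    using fin card_Int_Diff by metis+
  ultimately show ?thesis by (simp add: Int_commute)
qed

lemma matroid_space: "matroid (space_matroid E Z)"
proof
  fix I J assume I: "I \<in> indeps (space_matroid E Z)" and J: "J \<in> indeps (space_matroid E Z)"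
    and less: "card I < card J"
  then have "\<exists>e \<in> J - I. cycle_free Z (insert e I)"
    using card_le_if_no_augment[of I J] by (auto simp: not_le[symmetric])
  then show "\<exists>e \<in> J - I. insert e I \<in> indeps (space_matroid E Z)" using I J by auto
qed (use finite_E cycle_free_subset in \<open>auto simp: cycle_free_def\<close>)

lemma maximal_cycle_free:
  assumes "T \<subseteq> E"
  obtains J where "J \<subseteq> T" "cycle_free Z J" "\<And>e. e \<in> T - J \<Longrightarrow> \<not> cycle_free Z (insert e J)"
proof -
  have fin: "finite T" using assms finite_E finite_subset by blast
  let ?F = "{J. J \<subseteq> T \<and> cycle_free Z J}"
  have "{} \<in> ?F" by (auto simp: cycle_free_def)
  then have ne: "?F \<noteq> {}" by (metis empty_iff)
  have "finite ?F" using fin by simp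
  from finite_has_maximal[OF this ne] obtain J
    where J: "J \<in> ?F" and max: "\<forall>K \<in> ?F. J \<subseteq> K \<longrightarrow> J = K"
    by (rule bexE)
  show thesis
  proof (rule that)
    fix e assume e: "e \<in> T - J"
    show "\<not> cycle_free Z (insert e J)"
      using max J e by blast
  qed (use J in auto)
qed

text \<open>
  Contraction of \<open>C\<close> in terms of cycles: as every element of \<open>C\<close> outside the basis \<open>J\<close> of \<open>C\<close> can be
  cleared from a cycle by adding a cycle inside \<open>C\<close>, a cycle inside \<open>I \<union> C\<close> that meets \<open>I\<close> exists iff
  one inside \<open>I \<union> J\<close> does.
\<close>

lemma cycle_free_Un_maximal:
  assumes C: "C \<subseteq> E" and J: "J \<subseteq> C" "cycle_free Z J"
    and max: "\<And>e. e \<in> C - J \<Longrightarrow> \<not> cycle_free Z (insert e J)"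
    and I: "I \<inter> C = {}"
  shows "cycle_free Z (I \<union> J) \<longleftrightarrow> (\<forall>S \<in> Z. S \<subseteq> I \<union> C \<longrightarrow> S \<subseteq> C)"
proof
  assume free: "cycle_free Z (I \<union> J)"
  obtain D where D: "\<And>e. e \<in> C - J \<Longrightarrow> D e \<in> Z \<and> D e \<subseteq> insert e J \<and> e \<in> D e"
    using new_cycle[OF J(2) max] by metis
  show "\<forall>S \<in> Z. S \<subseteq> I \<union> C \<longrightarrow> S \<subseteq> C"
  proof (intro ballI impI)
    fix S assume S: "S \<in> Z" "S \<subseteq> I \<union> C"
    have "S = cyc_comb D (S \<inter> (C - J))"
      by (rule eq_comb_of_new_cycles[OF S(1) free]) (use S(2) I D in blast)+
    moreover have "cyc_comb D (S \<inter> (C - J)) \<subseteq> C"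
      using cyc_comb_subset[of D "S \<inter> (C - J)"] D J(1) by blast
    ultimately show "S \<subseteq> C" by simp
  qed
next
  assume r: "\<forall>S \<in> Z. S \<subseteq> I \<union> C \<longrightarrow> S \<subseteq> C"
  show "cycle_free Z (I \<union> J)"
    unfolding cycle_free_def
  proof (intro ballI impI)
    fix S assume S: "S \<in> Z" "S \<subseteq> I \<union> J"
    then have "S \<subseteq> C" using r J(1) by (meson Un_mono order_refl order_trans)
    then have "S \<subseteq> J" using S(2) I by blast
    then show "S = {}" using J(2) S(1) unfolding cycle_free_def by simp
  qed
qed

lemma basis_of_space_matroid:
  assumes "T \<subseteq> E"
  shows "basis_of (space_matroid E Z) T J \<longleftrightarrow>
    J \<subseteq> T \<and> cycle_free Z J \<and> (\<forall>e \<in> T - J. \<not> cycle_free Z (insert e J))"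
proof
  assume b: "basis_of (space_matroid E Z) T J"
  have "\<not> cycle_free Z (insert e J)" if "e \<in> T - J" for e
  proof
    assume "cycle_free Z (insert e J)"
    then have "insert e J \<in> indeps (space_matroid E Z) \<and> J \<subseteq> insert e J \<and> insert e J \<subseteq> T"
      using b that assms unfolding basis_of_def by auto
    then have "insert e J = J" using b unfolding basis_of_def by blast
    then show False using that by blast
  qed
  then show "J \<subseteq> T \<and> cycle_free Z J \<and> (\<forall>e \<in> T - J. \<not> cycle_free Z (insert e J))"
    using b unfolding basis_of_def by auto
next
  assume r: "J \<subseteq> T \<and> cycle_free Z J \<and> (\<forall>e \<in> T - J. \<not> cycle_free Z (insert e J))"
  have "K = J" if K: "K \<in> indeps (space_matroid E Z)" "J \<subseteq> K" "K \<subseteq> T" for K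
  proof (rule ccontr)
    assume "K \<noteq> J"
    then obtain e where e: "e \<in> K" "e \<notin> J" using K(2) by blast
    then have "cycle_free Z (insert e J)" using K cycle_free_subset[of Z K "insert e J"] by auto
    then show False using r e K(3) by blast
  qed
  then show "basis_of (space_matroid E Z) T J"
    unfolding basis_of_def using r assms by auto
qed

lemma indep_minor_iff:
  assumes C: "C \<subseteq> E"
  shows "X \<in> indeps (matroid_delete (matroid_contract (space_matroid E Z) C) D) \<longleftrightarrow>
    X \<subseteq> E - C - D \<and> (\<forall>S \<in> Z. S \<subseteq> X \<union> C \<longrightarrow> S \<subseteq> C)"
proof -
  have "(\<exists>J. basis_of (space_matroid E Z) C J \<and> X \<union> J \<subseteq> E \<and> cycle_free Z (X \<union> J)) \<longleftrightarrow>
      (\<forall>S \<in> Z. S \<subseteq> X \<union> C \<longrightarrow> S \<subseteq> C)" if X: "X \<subseteq> E - C"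
  proof -
    have XC: "X \<inter> C = {}" using X by blast
    obtain J where J: "J \<subseteq> C" "cycle_free Z J" "\<And>e. e \<in> C - J \<Longrightarrow> \<not> cycle_free Z (insert e J)"
      using maximal_cycle_free[OF C] by blast
    show ?thesis
    proof
      assume "\<exists>J. basis_of (space_matroid E Z) C J \<and> X \<union> J \<subseteq> E \<and> cycle_free Z (X \<union> J)"
      then obtain K where K: "K \<subseteq> C" "cycle_free Z K"
        "\<And>e. e \<in> C - K \<Longrightarrow> \<not> cycle_free Z (insert e K)" "cycle_free Z (X \<union> K)"
        unfolding basis_of_space_matroid[OF C] by blast
      then show "\<forall>S \<in> Z. S \<subseteq> X \<union> C \<longrightarrow> S \<subseteq> C"
        using cycle_free_Un_maximal[OF C K(1-3) XC] by simp
    next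
      assume "\<forall>S \<in> Z. S \<subseteq> X \<union> C \<longrightarrow> S \<subseteq> C"
      then have "cycle_free Z (X \<union> J)" using cycle_free_Un_maximal[OF C J XC] by simp
      then show "\<exists>J. basis_of (space_matroid E Z) C J \<and> X \<union> J \<subseteq> E \<and> cycle_free Z (X \<union> J)"
        unfolding basis_of_space_matroid[OF C] using J X C by blast
    qed
  qed
  then show ?thesis
    unfolding matroid_delete_def matroid_restrict_def matroid_contract_def by auto
qed

lemma ground_minor:
  "ground (matroid_delete (matroid_contract (space_matroid E Z) C) D) = E - C - D"
  unfolding matroid_delete_def matroid_restrict_def matroid_contract_def by auto

end

text \<open>
  A basis \<open>B\<close> together with the fundamental circuits \<open>{e} \<union> F e\<close> of the elements outside it. Column
  \<open>e\<close> of the representing matrix in standard form is the indicator of \<open>F e\<close>.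
\<close>

locale cycle_space_basis = cycle_space +
  fixes B :: "'a set" and F :: "'a \<Rightarrow> 'a set"
  assumes basis_subset: "B \<subseteq> E" and basis_free: "cycle_free Z B"
    and fund: "e \<in> E - B \<Longrightarrow> F e \<subseteq> B \<and> insert e (F e) \<in> Z"
begin

lemma finite_cobasis_subset: "T \<subseteq> E - B \<Longrightarrow> finite T"
  using finite_E finite_subset by blast

lemma F_subset: "e \<in> E - B \<Longrightarrow> F e \<subseteq> B"
  using fund by blast

lemma cycle_eq_comb:
  assumes S: "S \<in> Z"
  shows "S = cyc_comb (\<lambda>e. insert e (F e)) (S - B)"
proof (rule eq_comb_of_new_cycles[OF S basis_free])
  fix e assume "e \<in> S - B"
  then have "e \<in> E - B" using cycle_subset[OF S] by blast
  then show "insert e (F e) \<in> Z \<and> e \<in> insert e (F e) \<and> insert e (F e) \<subseteq> insert e B"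
    using fund by blast
qed auto

text \<open>
  The part of a cycle outside the basis is arbitrary and determines the part inside it.
\<close>

lemma cycle_iff:
  "S \<in> Z \<longleftrightarrow> S \<subseteq> E \<and> (\<forall>b \<in> B. b \<in> S \<longleftrightarrow> odd_count (\<lambda>e. b \<in> F e) (S - B))"
proof -
  let ?C = "\<lambda>e. insert e (F e)"
  have comb: "x \<in> cyc_comb ?C (S - B) \<longleftrightarrow>
      (if x \<in> B then odd_count (\<lambda>e. x \<in> F e) (S - B) else x \<in> S)" if S: "S \<subseteq> E" for x
  proof (cases "x \<in> B")
    case True
    then have "{e \<in> S - B. x \<in> ?C e} = {e \<in> S - B. x \<in> F e}" by auto
    then show ?thesis using True by (simp add: cyc_comb_def odd_count_def)
  next
    case False
    have "x \<in> ?C e \<longleftrightarrow> e = x" if "e \<in> S - B" for e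
      using False F_subset[of e] that S by auto
    then have "x \<in> cyc_comb ?C (S - B) \<longleftrightarrow> x \<in> S - B" by (rule mem_cyc_comb_single)
    then show ?thesis using False by simp
  qed
  show ?thesis
  proof
    assume S: "S \<in> Z"
    then have sub: "S \<subseteq> E" by (rule cycle_subset)
    show "S \<subseteq> E \<and> (\<forall>b \<in> B. b \<in> S \<longleftrightarrow> odd_count (\<lambda>e. b \<in> F e) (S - B))"
      using comb[OF sub] cycle_eq_comb[OF S] sub by metis
  next
    assume S: "S \<subseteq> E \<and> (\<forall>b \<in> B. b \<in> S \<longleftrightarrow> odd_count (\<lambda>e. b \<in> F e) (S - B))"
    then have "x \<in> S \<longleftrightarrow> x \<in> cyc_comb ?C (S - B)" for x using comb by simp
    then have "S = cyc_comb ?C (S - B)" by blast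
    moreover have "cyc_comb ?C (S - B) \<in> Z"
      using S fund finite_cobasis_subset[of "S - B"] by (intro cyc_comb_cycle) blast+
    ultimately show "S \<in> Z" by simp
  qed
qed

end

lemma (in cycle_space) basis_exists:
  obtains B F where "cycle_space_basis E Z B F"
proof -
  obtain B where B: "B \<subseteq> E" "cycle_free Z B" "\<And>e. e \<in> E - B \<Longrightarrow> \<not> cycle_free Z (insert e B)"
    using maximal_cycle_free[OF subset_refl] by blast
  obtain C where C: "\<And>e. e \<in> E - B \<Longrightarrow> C e \<in> Z \<and> C e \<subseteq> insert e B \<and> e \<in> C e"
    using new_cycle[OF B(2,3)] by metis
  have "cycle_space_basis E Z B (\<lambda>e. C e - {e})"
  proof
    fix e assume e: "e \<in> E - B"
    then have "insert e (C e - {e}) = C e" using C by blast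
    then show "C e - {e} \<subseteq> B \<and> insert e (C e - {e}) \<in> Z" using C[OF e] by auto
  qed (use B in auto)
  then show thesis by (rule that)
qed

section \<open>Cycle spaces of binary matroids and of element splittings\<close>

text \<open>
  The cycle of the element splitting that restricts to \<open>S\<close>: the new row forces the new element to
  correct the parity of \<open>S \<inter> H\<close>.
\<close>

definition lift_cycle :: "'a set \<Rightarrow> 'a set \<Rightarrow> 'a option set" where
  "lift_cycle H S = Some ` S \<union> (if odd (card (S \<inter> H)) then {None} else {})"

lemma cycle_free_lift:
  "cycle_free (lift_cycle H ` Z) I \<longleftrightarrow>
    (\<forall>S \<in> Z. Some ` S \<subseteq> I \<and> (odd (card (S \<inter> H)) \<longrightarrow> None \<in> I) \<longrightarrow> S = {})"
proof -
  have "lift_cycle H S \<subseteq> I \<longleftrightarrow> Some ` S \<subseteq> I \<and> (odd (card (S \<inter> H)) \<longrightarrow> None \<in> I)" for S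
    by (auto simp: lift_cycle_def)
  moreover have "lift_cycle H S = {} \<longleftrightarrow> S = {}" for S by (auto simp: lift_cycle_def)
  ultimately show ?thesis unfolding cycle_free_def by simp
qed

lemma bit_sum_indicator:
  assumes "finite S"
  shows "(\<Sum>x\<in>S. if P x then 1 else (0::bit)) = of_bool (odd (card {x \<in> S. P x}))"
  using assms
proof (induction S)
  case (insert a S)
  have "{x \<in> insert a S. P x} = (if P a then insert a {x \<in> S. P x} else {x \<in> S. P x})" by auto
  then show ?case using insert by auto
qed simp

lemma null_cols_sym_diff:
  fixes A :: "nat \<Rightarrow> 'a \<Rightarrow> bit"
  assumes "finite S" "finite T" "null_cols m A S" "null_cols m A T"
  shows "null_cols m A (sym_diff S T)"
proof -
  have "(\<Sum>e\<in>sym_diff S T. A i e) = (\<Sum>e\<in>S. A i e) + (\<Sum>e\<in>T. A i e)" for i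
  proof -
    have "(\<Sum>e\<in>sym_diff S T. A i e) = (\<Sum>e\<in>S - T. A i e) + (\<Sum>e\<in>T - S. A i e)"
      using assms by (intro sum.union_disjoint) auto
    moreover have "(\<Sum>e\<in>S. A i e) = (\<Sum>e\<in>S \<inter> T. A i e) + (\<Sum>e\<in>S - T. A i e)"
      using assms(1) by (rule sum.Int_Diff)
    moreover have "(\<Sum>e\<in>T. A i e) = (\<Sum>e\<in>S \<inter> T. A i e) + (\<Sum>e\<in>T - S. A i e)"
      using sum.Int_Diff[OF assms(2), of "A i" S] by (simp add: Int_commute)
    ultimately show ?thesis
      by (cases "\<Sum>e\<in>S \<inter> T. A i e") (auto simp: algebra_simps)
  qed
  then show ?thesis using assms(3,4) unfolding null_cols_def by simp
qed

lemma vector_matroid_bit: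
  fixes A :: "nat \<Rightarrow> 'a \<Rightarrow> bit"
  assumes "finite E"
  shows "cycle_space E {S. S \<subseteq> E \<and> null_cols m A S}"
    and "vector_matroid m A E = space_matroid E {S. S \<subseteq> E \<and> null_cols m A S}"
proof -
  show "cycle_space E {S. S \<subseteq> E \<and> null_cols m A S}"
  proof
    fix S T assume "S \<in> {S. S \<subseteq> E \<and> null_cols m A S}" "T \<in> {S. S \<subseteq> E \<and> null_cols m A S}"
    then show "sym_diff S T \<in> {S. S \<subseteq> E \<and> null_cols m A S}"
      using null_cols_sym_diff[of S T m A] assms finite_subset by blast
  qed (use assms in \<open>auto simp: null_cols_def\<close>)
  have "cols_indep m A X \<longleftrightarrow> cycle_free {S. S \<subseteq> E \<and> null_cols m A S} X" if "X \<subseteq> E" for X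
  proof -
    have "finite X" using that assms by (rule finite_subset)
    then show ?thesis
      unfolding cols_indep_iff_null_cols[OF \<open>finite X\<close>] cycle_free_def using that
      by (auto dest: subset_trans)
  qed
  then show "vector_matroid m A E = space_matroid E {S. S \<subseteq> E \<and> null_cols m A S}"
    unfolding vector_matroid_def space_matroid_def by auto
qed

lemma null_cols_split_iff_lift:
  fixes A :: "nat \<Rightarrow> 'a \<Rightarrow> bit"
  assumes fin: "finite E"
  shows "{S. S \<subseteq> insert None (Some ` E) \<and> null_cols (Suc m) (split_matrix m A H) S} =
    lift_cycle H ` {S. S \<subseteq> E \<and> null_cols m A S}"
proof -
  have par: "(\<Sum>x\<in>S. case x of None \<Rightarrow> 1 | Some e \<Rightarrow> if e \<in> H then 1 else (0::bit)) = 0 \<longleftrightarrow>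
      S = lift_cycle H {e. Some e \<in> S}" if S: "S \<subseteq> insert None (Some ` E)" for S
  proof -
    have finS: "finite S" using S fin by (meson finite.insertI finite_imageI finite_subset)
    let ?P = "\<lambda>x. x = None \<or> (\<exists>e\<in>H. x = Some e)"
    let ?T = "{e. Some e \<in> S}"
    have "(\<Sum>x\<in>S. case x of None \<Rightarrow> 1 | Some e \<Rightarrow> if e \<in> H then 1 else (0::bit)) =
        (\<Sum>x\<in>S. if ?P x then 1 else 0)"
      by (rule sum.cong) (auto split: option.splits)
    also have "\<dots> = of_bool (odd (card {x \<in> S. ?P x}))" by (rule bit_sum_indicator[OF finS])
    also have "{x \<in> S. ?P x} = Some ` (?T \<inter> H) \<union> (S \<inter> {None})" by auto
    also have "card \<dots> = card (?T \<inter> H) + card (S \<inter> {None})"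
    proof (subst card_Un_disjoint)
      show "finite (Some ` (?T \<inter> H))" using finS by (rule rev_finite_subset) auto
    qed (use finS in \<open>auto simp: card_image\<close>)
    finally have "(\<Sum>x\<in>S. case x of None \<Rightarrow> 1 | Some e \<Rightarrow> if e \<in> H then 1 else (0::bit)) = 0 \<longleftrightarrow>
        (None \<in> S \<longleftrightarrow> odd (card (?T \<inter> H)))"
      by (cases "None \<in> S") auto
    moreover have "S = Some ` ?T \<union> (if None \<in> S then {None} else {})"
      using S by auto
    ultimately show ?thesis unfolding lift_cycle_def by auto
  qed
  have unlift: "{e. Some e \<in> lift_cycle H T} = T" for T by (auto simp: lift_cycle_def)
  have range: "lift_cycle H T \<subseteq> insert None (Some ` E)" if "T \<subseteq> E" for T
    using that by (auto simp: lift_cycle_def)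
  show ?thesis
  proof (intro subset_antisym subsetI)
    fix S assume "S \<in> {S. S \<subseteq> insert None (Some ` E) \<and> null_cols (Suc m) (split_matrix m A H) S}"
    then have S: "S \<subseteq> insert None (Some ` E)" "null_cols (Suc m) (split_matrix m A H) S" by auto
    then have "null_cols m A {e. Some e \<in> S}" "S = lift_cycle H {e. Some e \<in> S}"
      using null_cols_split_matrix[OF fin S(1)] par[OF S(1)] by blast+
    moreover have "{e. Some e \<in> S} \<subseteq> E" using S(1) by auto
    ultimately show "S \<in> lift_cycle H ` {S. S \<subseteq> E \<and> null_cols m A S}" by blast
  next
    fix S assume "S \<in> lift_cycle H ` {S. S \<subseteq> E \<and> null_cols m A S}"
    then obtain T where T: "T \<subseteq> E" "null_cols m A T" "S = lift_cycle H T" by blast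
    then show "S \<in> {S. S \<subseteq> insert None (Some ` E) \<and> null_cols (Suc m) (split_matrix m A H) S}"
      using null_cols_split_matrix[OF fin range[OF T(1)]] par[OF range[OF T(1)]] range[OF T(1)] unlift
      by simp
  qed
qed

text \<open>
  The interface to matrices: from here on, \<open>M\<close> and all its element splittings are given by one cycle
  space \<open>Z\<close>.
\<close>

lemma binary_cycle_space:
  assumes "binary M"
  obtains Z where "cycle_space (ground M) Z" "M = space_matroid (ground M) Z"
    "\<And>H. cycle_space (insert None (Some ` ground M)) (lift_cycle H ` Z) \<and>
      element_splitting M H = space_matroid (insert None (Some ` ground M)) (lift_cycle H ` Z) \<and>
      binary (element_splitting M H)"
proof -
  obtain m and A :: "nat \<Rightarrow> 'a \<Rightarrow> bit" where rep: "represents m A M" and mat: "matroid M"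
    using assms unfolding binary_def by blast
  have fin: "finite (ground M)" using matroid.finite_ground[OF mat] .
  let ?E = "ground M" and ?Z = "{S. S \<subseteq> ground M \<and> null_cols m A S}"
  let ?E' = "insert None (Some ` ?E)"
  have "M = space_matroid ?E ?Z"
    using rep vector_matroid_bit(2)[OF fin, of m A] unfolding represents_def by simp
  moreover have "cycle_space ?E' (lift_cycle H ` ?Z) \<and>
      element_splitting M H = space_matroid ?E' (lift_cycle H ` ?Z) \<and>
      binary (element_splitting M H)" for H
  proof -
    have fin': "finite ?E'" using fin by simp
    note v = vector_matroid_bit[OF fin', of "Suc m" "split_matrix m A H",
        unfolded null_cols_split_iff_lift[OF fin]]
    have eq: "element_splitting M H = vector_matroid (Suc m) (split_matrix m A H) ?E'"
      unfolding element_splitting_eq[OF fin rep] split_vector_matroid_def ..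
    then have "represents (Suc m) (split_matrix m A H) (element_splitting M H)"
      unfolding represents_def by (simp add: vector_matroid_def)
    moreover have "matroid (element_splitting M H)"
      using cycle_space.matroid_space[OF v(1)] v(2) eq by simp
    ultimately show ?thesis using v eq unfolding binary_def by auto
  qed
  ultimately show thesis using that[OF vector_matroid_bit(1)[OF fin, of m A]] by blast
qed

section \<open>The cycle matroid of G6\<close>

definition G6_circuits :: "nat set set" where
  "G6_circuits = {{0, 1}, {2, 3}, {0, 2, 4}, {0, 3, 4}, {1, 2, 4}, {1, 3, 4}}"

lemma G6_simps:
  "vertices G6 = {0, 1, 2}" "edges G6 = {0, 1, 2, 3, 4}"
  "ends G6 0 = {0, 1}" "ends G6 (Suc 0) = {0, 1}" "ends G6 2 = {0, 2}" "ends G6 3 = {0, 2}"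
  "ends G6 4 = {1, 2}"
  by (simp_all add: G6_def numeral_eq_Suc)

lemma G6_circuit_cycle:
  assumes "c \<in> G6_circuits"
  shows "\<exists>vs es. is_cycle G6 vs es \<and> set es = c"
proof -
  have tri: "is_cycle G6 [0, 1, 2] [a, 4, b]" if "a \<in> {0, 1}" "b \<in> {2, 3}" for a b
    using that by (auto simp: is_cycle_def G6_simps All_less_Suc)
  have par: "is_cycle G6 [0, 1] [0, 1]" "is_cycle G6 [0, 2] [2, 3]"
    by (auto simp: is_cycle_def G6_simps All_less_Suc)
  let ?L = "{[0, 1], [2, 3], [0, 4, 2], [0, 4, 3], [1, 4, 2], [1, 4, 3 :: nat]}"
  have "set ` ?L = G6_circuits"
    unfolding G6_circuits_def by (simp add: insert_commute)
  then obtain es where es: "es \<in> ?L" "c = set es" using assms by blast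
  from es(1) have "\<exists>vs. is_cycle G6 vs es"
    using par tri[of 0 2] tri[of 0 3] tri[of 1 2] tri[of 1 3] by (elim insertE emptyE) (simp; blast)+
  then show ?thesis using es(2) by blast
qed

lemma G6_cycle_circuit:
  assumes "is_cycle G6 vs es"
  shows "\<exists>c \<in> G6_circuits. c \<subseteq> set es"
proof -
  have vs: "distinct vs" "set vs \<subseteq> {0, 1, 2}" "length vs = length es" "es \<noteq> []" "distinct es"
    "set es \<subseteq> {0, 1, 2, 3, 4}"
    and ends: "\<And>i. i < length es \<Longrightarrow> ends G6 (es ! i) = {vs ! i, vs ! (Suc i mod length es)}"
    using assms unfolding is_cycle_def by (auto simp: G6_simps)
  have "length vs \<le> card {0, 1, 2 :: nat}"
    using vs(1,2) by (metis distinct_card card_mono finite.emptyI finite_insert)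
  then have "length es \<le> 3" using vs(3) by simp
  moreover have "length es \<noteq> 0" using vs(4) by simp
  ultimately consider "length es = 1" | "length es = 2" | "length es = 3" by linarith
  then show ?thesis
  proof cases
    case 1
    then obtain a where a: "es = [a]" by (auto simp: length_Suc_conv)
    have "card (ends G6 a) = 2" using vs(6) a by (auto simp: G6_simps)
    moreover have "card (ends G6 a) = 1" using ends[of 0] a by simp
    ultimately show ?thesis by simp
  next
    case 2
    then obtain a b where ab: "es = [a, b]" by (auto simp: length_Suc_conv numeral_2_eq_2)
    have "ends G6 a = ends G6 b" using ends[of 0] ends[of 1] ab by (simp add: insert_commute)
    then have "{a, b} = {0, 1} \<or> {a, b} = {2, 3}"
      using vs(5,6) ab by (auto simp: G6_simps doubleton_eq_iff)
    then have "{a, b} \<in> G6_circuits" unfolding G6_circuits_def by (elim disjE) simp_all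
    then have "set es \<in> G6_circuits" using ab by simp
    then show ?thesis by blast
  next
    case 3
    then obtain a b c where abc: "es = [a, b, c]" by (auto simp: length_Suc_conv numeral_3_eq_3)
    obtain x y z where xyz: "vs = [x, y, z]"
      using 3 vs(3) by (auto simp: length_Suc_conv numeral_3_eq_3)
    have e: "ends G6 a = {x, y}" "ends G6 b = {y, z}" "ends G6 c = {z, x}"
      using ends[of 0] ends[of 1] ends[of 2] abc xyz by auto
    have ne: "ends G6 a \<noteq> ends G6 b" "ends G6 b \<noteq> ends G6 c" "ends G6 a \<noteq> ends G6 c"
      using vs(1) xyz unfolding e by (auto simp: doubleton_eq_iff)
    have "a \<in> {0, 1, 2, 3, 4}" "b \<in> {0, 1, 2, 3, 4}" "c \<in> {0, 1, 2, 3, 4}"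
      using vs(6) abc by auto
    then have "{a, b, c} \<in> G6_circuits"
      using ne by (elim insertE emptyE; simp add: G6_simps G6_circuits_def insert_commute)
    then show ?thesis using abc by auto
  qed
qed

lemma indep_cycle_matroid_G6:
  "X \<in> indeps (cycle_matroid G6) \<longleftrightarrow> X \<subseteq> {0, 1, 2, 3, 4} \<and> (\<forall>c \<in> G6_circuits. \<not> c \<subseteq> X)"
proof -
  have "(\<exists>vs es. is_cycle G6 vs es \<and> set es \<subseteq> X) \<longleftrightarrow> (\<exists>c \<in> G6_circuits. c \<subseteq> X)"
  proof
    assume "\<exists>vs es. is_cycle G6 vs es \<and> set es \<subseteq> X"
    then obtain vs es where es: "is_cycle G6 vs es" "set es \<subseteq> X" by (elim exE conjE)
    obtain c where c: "c \<in> G6_circuits" "c \<subseteq> set es"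
      using G6_cycle_circuit[OF es(1)] by (elim bexE)
    from c(1) subset_trans[OF c(2) es(2)] show "\<exists>c \<in> G6_circuits. c \<subseteq> X" by (rule bexI[rotated])
  next
    assume "\<exists>c \<in> G6_circuits. c \<subseteq> X"
    then obtain c where c: "c \<in> G6_circuits" "c \<subseteq> X" by (elim bexE)
    obtain vs es where es: "is_cycle G6 vs es" "set es = c"
      using G6_circuit_cycle[OF c(1)] by (elim exE conjE)
    have "set es \<subseteq> X" using es(2) c(2) by simp
    with es(1) show "\<exists>vs es. is_cycle G6 vs es \<and> set es \<subseteq> X" by (intro exI conjI)
  qed
  then show ?thesis by (auto simp: cycle_matroid_def G6_simps)
qed

lemma G6_circuits_antichain:
  assumes "c \<in> G6_circuits" "d \<in> G6_circuits" "c \<subseteq> d"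
  shows "c = d"
  using assms unfolding G6_circuits_def by (elim insertE emptyE; simp)

lemma G6_circuit_subset: "c \<in> G6_circuits \<Longrightarrow> c \<subseteq> {0, 1, 2, 3, 4}"
  unfolding G6_circuits_def by auto

text \<open>
  An isomorphism with \<open>M(G6)\<close> is a labelling of the elements by \<open>0, \<dots>, 4\<close> under which the circuits are
  those of \<open>G6\<close>.
\<close>

lemma matroid_iso_G6_iff:
  "matroid_iso N (cycle_matroid G6) \<longleftrightarrow>
    (\<exists>x. inj_on x {0, 1, 2, 3, 4 :: nat} \<and> ground N = x ` {0, 1, 2, 3, 4} \<and>
      (\<forall>X \<subseteq> ground N. X \<in> indeps N \<longleftrightarrow> (\<forall>c \<in> G6_circuits. \<not> x ` c \<subseteq> X)))"
  (is "?iso \<longleftrightarrow> ?labels")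
proof -
  let ?n = "{0, 1, 2, 3, 4 :: nat}"
  have gr: "ground (cycle_matroid G6) = ?n" by (simp add: cycle_matroid_def G6_simps)
  have transfer: "\<phi> ` X \<in> indeps (cycle_matroid G6) \<longleftrightarrow> (\<forall>c \<in> G6_circuits. \<not> x ` c \<subseteq> X)"
    if inv: "\<And>k. k \<in> ?n \<Longrightarrow> \<phi> (x k) = k" "\<And>e. e \<in> ground N \<Longrightarrow> x (\<phi> e) = e"
      and maps: "\<phi> ` ground N = ?n" and X: "X \<subseteq> ground N" for \<phi> x X
  proof -
    have "c \<subseteq> \<phi> ` X \<longleftrightarrow> x ` c \<subseteq> X" if c: "c \<in> G6_circuits" for c
    proof
      assume "c \<subseteq> \<phi> ` X"
      then have "x ` c \<subseteq> x ` \<phi> ` X" by (rule image_mono)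
      also have "x ` \<phi> ` X = (\<lambda>e. e) ` X"
        unfolding image_image by (rule image_cong[OF refl inv(2)]) (use X in blast)
      also have "\<dots> = X" by simp
      finally show "x ` c \<subseteq> X" .
    next
      assume "x ` c \<subseteq> X"
      then have "\<phi> ` x ` c \<subseteq> \<phi> ` X" by (rule image_mono)
      also have "\<phi> ` x ` c = (\<lambda>k. k) ` c"
        unfolding image_image by (rule image_cong[OF refl inv(1)]) (use G6_circuit_subset[OF c] in blast)
      also have "\<dots> = c" by simp
      finally show "c \<subseteq> \<phi> ` X" .
    qed
    moreover have "\<phi> ` X \<subseteq> ?n" using image_mono[OF X, of \<phi>] maps by simp
    ultimately show ?thesis unfolding indep_cycle_matroid_G6 by simp
  qed
  show ?thesis
  proof
    assume ?iso
    then obtain \<phi> where \<phi>: "bij_betw \<phi> (ground N) ?n"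
      "\<forall>X \<subseteq> ground N. X \<in> indeps N \<longleftrightarrow> \<phi> ` X \<in> indeps (cycle_matroid G6)"
      unfolding matroid_iso_def gr by (elim exE conjE)
    define x where "x = inv_into (ground N) \<phi>"
    have bij: "bij_betw x ?n (ground N)" unfolding x_def by (rule bij_betw_inv_into[OF \<phi>(1)])
    have ind: "X \<in> indeps N \<longleftrightarrow> (\<forall>c \<in> G6_circuits. \<not> x ` c \<subseteq> X)" if X: "X \<subseteq> ground N" for X
    proof -
      have "\<phi> ` X \<in> indeps (cycle_matroid G6) \<longleftrightarrow> (\<forall>c \<in> G6_circuits. \<not> x ` c \<subseteq> X)"
      proof (rule transfer[OF _ _ _ X])
        show "\<phi> (x k) = k" if "k \<in> ?n" for k
          unfolding x_def by (rule bij_betw_inv_into_right[OF \<phi>(1) that])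
        show "x (\<phi> e) = e" if "e \<in> ground N" for e
          unfolding x_def by (rule bij_betw_inv_into_left[OF \<phi>(1) that])
        show "\<phi> ` ground N = ?n" by (rule bij_betw_imp_surj_on[OF \<phi>(1)])
      qed
      then show ?thesis using \<phi>(2) X by simp
    qed
    show ?labels
      by (intro exI[of _ x] conjI allI impI ind bij_betw_imp_inj_on[OF bij]
          bij_betw_imp_surj_on[OF bij, symmetric])
  next
    assume ?labels
    then obtain x where x: "inj_on x ?n" "ground N = x ` ?n"
      "\<forall>X \<subseteq> ground N. X \<in> indeps N \<longleftrightarrow> (\<forall>c \<in> G6_circuits. \<not> x ` c \<subseteq> X)"
      by (elim exE conjE)
    define \<phi> where "\<phi> = inv_into ?n x"
    have bx: "bij_betw x ?n (ground N)" using x unfolding bij_betw_def by simp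
    have bij: "bij_betw \<phi> (ground N) ?n" unfolding \<phi>_def by (rule bij_betw_inv_into[OF bx])
    have "X \<in> indeps N \<longleftrightarrow> \<phi> ` X \<in> indeps (cycle_matroid G6)" if X: "X \<subseteq> ground N" for X
    proof -
      have "\<phi> ` X \<in> indeps (cycle_matroid G6) \<longleftrightarrow> (\<forall>c \<in> G6_circuits. \<not> x ` c \<subseteq> X)"
      proof (rule transfer[OF _ _ _ X])
        show "\<phi> (x k) = k" if "k \<in> ?n" for k
          unfolding \<phi>_def by (rule bij_betw_inv_into_left[OF bx that])
        show "x (\<phi> e) = e" if "e \<in> ground N" for e
          unfolding \<phi>_def by (rule bij_betw_inv_into_right[OF bx that])
        show "\<phi> ` ground N = ?n" by (rule bij_betw_imp_surj_on[OF bij])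
      qed
      then show ?thesis using x(3) X by simp
    qed
    then show ?iso unfolding matroid_iso_def gr by (intro exI[of _ \<phi>] conjI bij) simp
  qed
qed

lemma matroid_iso_G6I:
  assumes "distinct [x0, x1, x2, x3, x4]" "ground N = {x0, x1, x2, x3, x4}"
    and ind: "\<And>X. X \<in> indeps N \<longleftrightarrow> X \<subseteq> ground N \<and>
      \<not> (x0 \<in> X \<and> x1 \<in> X) \<and> \<not> (x2 \<in> X \<and> x3 \<in> X) \<and> \<not> (x0 \<in> X \<and> x2 \<in> X \<and> x4 \<in> X) \<and>
      \<not> (x0 \<in> X \<and> x3 \<in> X \<and> x4 \<in> X) \<and> \<not> (x1 \<in> X \<and> x2 \<in> X \<and> x4 \<in> X) \<and>
      \<not> (x1 \<in> X \<and> x3 \<in> X \<and> x4 \<in> X)"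
  shows "matroid_iso N (cycle_matroid G6)"
proof -
  let ?x = "\<lambda>k. [x0, x1, x2, x3, x4] ! k"
  have x: "?x 0 = x0" "?x (Suc 0) = x1" "?x 2 = x2" "?x 3 = x3" "?x 4 = x4"
    by (simp_all add: numeral_eq_Suc)
  have "inj_on ?x {0, 1, 2, 3, 4}"
    using assms(1) by (simp add: x)
  moreover have "ground N = ?x ` {0, 1, 2, 3, 4}" using assms(2) by (simp add: x)
  moreover have "X \<in> indeps N \<longleftrightarrow> (\<forall>c \<in> G6_circuits. \<not> ?x ` c \<subseteq> X)" if "X \<subseteq> ground N" for X
    unfolding ind G6_circuits_def using that by (simp add: x)
  ultimately show ?thesis unfolding matroid_iso_G6_iff by (intro exI[of _ ?x]) simp
qed

section \<open>Splitting a matroid with a minor M(G6)\<close>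

context cycle_space
begin

text \<open>
  Label the elements of the minor as \<open>x 0, \<dots>, x 4\<close> according to the edges of \<open>G6\<close> and choose
  \<open>H = {x 1, x 2, x 4}\<close>. The triangles \<open>{0, 2, 4}\<close> and \<open>{1, 3, 4}\<close> of \<open>G6\<close> meet \<open>{1, 2, 4}\<close> evenly and stay
  circuits, the pairs \<open>{0, 1}\<close> and \<open>{2, 3}\<close> meet it oddly and become triangles with the new
  element \<open>a\<close>. These are the four triangles of \<open>K4\<close>. In its bases \<open>{0, 1, 2}\<close> and \<open>{a, 3, 4}\<close> both \<open>1\<close> and
  \<open>2\<close> can be exchanged only with \<open>3\<close>, so the pairing required of a gammoid does not exist.
\<close>

lemma splitting_not_gammoid:
  assumes C: "C \<subseteq> E"
    and iso: "matroid_iso (matroid_delete (matroid_contract (space_matroid E Z) C) D) (cycle_matroid G6)"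
  shows "\<exists>H \<subseteq> E. card H = 3 \<and>
    \<not> gammoid (space_matroid (insert None (Some ` E)) (lift_cycle H ` Z))"
proof -
  define n where "n = {0, 1, 2, 3, 4 :: nat}"
  obtain x where x: "inj_on x n" "E - C - D = x ` n"
    and ind: "\<And>X. X \<subseteq> x ` n \<Longrightarrow>
      X \<in> indeps (matroid_delete (matroid_contract (space_matroid E Z) C) D) \<longleftrightarrow>
      (\<forall>c \<in> G6_circuits. \<not> x ` c \<subseteq> X)"
    using iso unfolding matroid_iso_G6_iff ground_minor n_def[symmetric] by (elim exE conjE) auto
  have circuit_n: "c \<subseteq> n" if "c \<in> G6_circuits" for c
    using G6_circuit_subset[OF that] unfolding n_def .
  have circuit_ne: "c \<noteq> {}" if "c \<in> G6_circuits" for c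
    using that unfolding G6_circuits_def by (elim insertE emptyE; simp)
  have n: "0 \<in> n" "1 \<in> n" "2 \<in> n" "3 \<in> n" "4 \<in> n" unfolding n_def by simp_all
  obtain J where J: "J \<subseteq> C" "cycle_free Z J" "\<And>e. e \<in> C - J \<Longrightarrow> \<not> cycle_free Z (insert e J)"
    using maximal_cycle_free[OF C] by blast
  have sub_image: "x ` c \<subseteq> x ` d \<longleftrightarrow> c \<subseteq> d" if "c \<subseteq> n" "d \<subseteq> n" for c d
  proof
    assume sub: "x ` c \<subseteq> x ` d"
    show "c \<subseteq> d"
    proof
      fix k assume "k \<in> c"
      then have "x k \<in> x ` d" "k \<in> n" using sub that(1) by auto
      then show "k \<in> d" using inj_on_image_mem_iff[OF x(1) _ that(2)] by simp
    qed
  qed (rule image_mono)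
  have key: "cycle_free Z (x ` d \<union> J) \<longleftrightarrow> (\<forall>c \<in> G6_circuits. \<not> c \<subseteq> d)" if d: "d \<subseteq> n" for d
  proof -
    have sub: "x ` d \<subseteq> E - C - D" unfolding x(2) using d by (rule image_mono)
    then have disj: "x ` d \<inter> C = {}" by blast
    have "cycle_free Z (x ` d \<union> J) \<longleftrightarrow> (\<forall>c \<in> G6_circuits. \<not> x ` c \<subseteq> x ` d)"
      using cycle_free_Un_maximal[OF C J disj] indep_minor_iff[OF C, of "x ` d" D] sub
        ind[of "x ` d"] x(2) by simp
    then show ?thesis using sub_image[OF circuit_n d] by simp
  qed
  have xJ: "x k \<notin> J" if "k \<in> n" for k using that x(2) J(1) by blast
  have trace: "\<exists>d \<subseteq> c. T \<inter> x ` n = x ` d \<and> T \<subseteq> x ` d \<union> J"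
    if T: "T \<subseteq> x ` c \<union> J" and c: "c \<subseteq> n" for T c
  proof (intro exI[of _ "{k \<in> c. x k \<in> T}"] conjI)
    show "T \<inter> x ` n = x ` {k \<in> c. x k \<in> T}"
    proof (intro equalityI subsetI)
      fix y assume y: "y \<in> T \<inter> x ` n"
      then have "y \<notin> J" using xJ by auto
      then obtain k where "k \<in> c" "y = x k" using T y by auto
      then show "y \<in> x ` {k \<in> c. x k \<in> T}" using y by simp
    qed (use c in auto)
    show "T \<subseteq> x ` {k \<in> c. x k \<in> T} \<union> J" using T by auto
  qed auto
  \<comment> \<open>A circuit of the minor extends to a cycle by elements of \<open>J\<close>; by minimality of the circuit, the
    cycle meets the five elements in nothing less.\<close>
  have circuit: "\<exists>T \<in> Z. T \<subseteq> x ` c \<union> J \<and> T \<inter> x ` n = x ` c" if c: "c \<in> G6_circuits" for c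
  proof -
    have cn: "c \<subseteq> n" using c by (rule circuit_n)
    obtain T where T: "T \<in> Z" "T \<subseteq> x ` c \<union> J" "T \<noteq> {}"
      using key[OF cn] c unfolding cycle_free_def by blast
    obtain d where d: "d \<subseteq> c" "T \<inter> x ` n = x ` d" "T \<subseteq> x ` d \<union> J"
      using trace[OF T(2) cn] by blast
    have "\<not> cycle_free Z (x ` d \<union> J)" using T d(3) unfolding cycle_free_def by blast
    then obtain c' where c': "c' \<in> G6_circuits" "c' \<subseteq> d"
      using key[of d] d(1) cn by (meson order_trans)
    then have "c' = c" using G6_circuits_antichain[OF c'(1) c] d(1) by blast
    then have "d = c" using c'(2) d(1) by blast
    then show ?thesis using T d(2) by blast
  qed
  let ?h = "{1, 2, 4 :: nat}"
  let ?H = "x ` ?h"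
  let ?Z = "lift_cycle ?H ` Z" and ?E = "insert None (Some ` E)"
  have hn: "?h \<subseteq> n" unfolding n_def by simp
  have xE: "x k \<in> E" if "k \<in> n" for k using x(2) that by blast
  have HE: "?H \<subseteq> E" using xE n by simp
  have inj_h: "inj_on x d" if "d \<subseteq> n" for d using x(1) that by (rule inj_on_subset)
  have cardH: "card ?H = 3" using card_image[OF inj_h[OF hn]] by simp
  have inter_aux: "P \<inter> Q = P \<inter> R \<inter> Q" if "Q \<subseteq> R" for P Q R :: "'a set" using that by blast
  have parity: "card (T \<inter> ?H) = card (d \<inter> ?h)" if "T \<inter> x ` n = x ` d" "d \<subseteq> n" for T d
  proof -
    have "?H \<subseteq> x ` n" using hn by (rule image_mono)
    then have "T \<inter> ?H = x ` d \<inter> ?H" unfolding that(1)[symmetric] by (rule inter_aux)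
    also have "\<dots> = x ` (d \<inter> ?h)" by (rule inj_on_image_Int[OF x(1) that(2) hn, symmetric])
    finally show ?thesis using card_image[OF inj_h[of "d \<inter> ?h"]] that(2) by (simp add: le_infI1)
  qed
  have dep_even: "\<not> cycle_free ?Z Y"
    if c: "c \<in> G6_circuits" "even (card (c \<inter> ?h))" "Some ` (x ` c \<union> J) \<subseteq> Y" for c Y
  proof -
    obtain T where T: "T \<in> Z" "T \<subseteq> x ` c \<union> J" "T \<inter> x ` n = x ` c" using circuit[OF c(1)] by blast
    have "even (card (T \<inter> ?H))" using parity[OF T(3) circuit_n[OF c(1)]] c(2) by simp
    moreover have "T \<noteq> {}" using T(3) circuit_ne[OF c(1)] by auto
    moreover have "Some ` T \<subseteq> Y" using T(2) c(3) by blast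
    ultimately show ?thesis using T(1) unfolding cycle_free_lift by blast
  qed
  have dep_None: "\<not> cycle_free ?Z Y"
    if c: "c \<in> G6_circuits" "None \<in> Y" "Some ` (x ` c \<union> J) \<subseteq> Y" for c Y
  proof -
    obtain T where T: "T \<in> Z" "T \<subseteq> x ` c \<union> J" "T \<inter> x ` n = x ` c" using circuit[OF c(1)] by blast
    have "T \<noteq> {}" using T(3) circuit_ne[OF c(1)] by auto
    moreover have "Some ` T \<subseteq> Y" using T(2) c(3) by blast
    ultimately show ?thesis using T(1) c(2) unfolding cycle_free_lift by blast
  qed
  have circuits: "{0, 1} \<in> G6_circuits" "{2, 3} \<in> G6_circuits" "{0, 2, 4} \<in> G6_circuits"
    "{0, 3, 4} \<in> G6_circuits" "{1, 3, 4} \<in> G6_circuits"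
    unfolding G6_circuits_def by simp_all
  define B1 where "B1 = Some ` (x ` {0, 1, 2} \<union> J)"
  define B2 where "B2 = insert None (Some ` (x ` {3, 4} \<union> J))"
  have JE: "J \<subseteq> E" using J(1) C by blast
  have free1: "cycle_free ?Z B1"
    unfolding cycle_free_lift
  proof (intro ballI impI, rule ccontr)
    fix T assume T: "T \<in> Z" "Some ` T \<subseteq> B1 \<and> (odd (card (T \<inter> ?H)) \<longrightarrow> None \<in> B1)" "T \<noteq> {}"
    then have TB: "T \<subseteq> x ` {0, 1, 2} \<union> J" and even: "even (card (T \<inter> ?H))" unfolding B1_def by auto
    obtain d where d: "d \<subseteq> {0, 1, 2}" "T \<inter> x ` n = x ` d" "T \<subseteq> x ` d \<union> J"
    proof -
      have "{0, 1, 2} \<subseteq> n" using n by simp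
      from trace[OF TB this] show thesis using that by (elim exE conjE)
    qed
    have dn: "d \<subseteq> n" using d(1) n by blast
    have "\<not> cycle_free Z (x ` d \<union> J)" using T(1,3) d(3) unfolding cycle_free_def by blast
    then obtain c where c: "c \<in> G6_circuits" "c \<subseteq> d" using key[OF dn] by blast
    have "c \<subseteq> {0, 1, 2}" using c(2) d(1) by (rule subset_trans)
    with c(1) have "c = {0, 1}" unfolding G6_circuits_def by (elim insertE emptyE; simp)
    then have d01: "x 0 \<in> T" "x 1 \<in> T" using c(2) d(2) by blast+
    \<comment> \<open>\<open>{0, 1}\<close> is the only circuit inside \<open>{0, 1, 2}\<close>, so \<open>T\<close> is its extension and meets \<open>H\<close> in \<open>x 1\<close>.\<close>
    obtain U where U: "U \<in> Z" "U \<subseteq> x ` {0, 1} \<union> J" "U \<inter> x ` n = x ` {0, 1}"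
      using circuit[OF circuits(1)] by blast
    let ?S = "sym_diff T U"
    have "x 0 \<in> U" "x 1 \<in> U" using U(3) by blast+
    with d01 have "?S \<subseteq> x ` {2} \<union> J" using TB U(2) by auto
    moreover have "cycle_free Z (x ` {2} \<union> J)"
      using n by (subst key) (simp_all add: G6_circuits_def)
    moreover have "?S \<in> Z" using T(1) U(1) by (rule sym_diff_cycle)
    ultimately have "?S = {}" unfolding cycle_free_def by blast
    then have "T = U" by blast
    then have "card (T \<inter> ?H) = card ({0, 1} \<inter> ?h)" using parity[OF U(3)] n by simp
    then show False using even by simp
  qed
  have free2: "cycle_free ?Z B2"
  proof -
    have "cycle_free Z (x ` {3, 4} \<union> J)" using n by (subst key) (simp_all add: G6_circuits_def)
    then have free: "T = {}" if "T \<in> Z" "T \<subseteq> x ` {3, 4} \<union> J" for T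
      using that unfolding cycle_free_def by simp
    have drop: "P \<subseteq> W" if "Some ` P \<subseteq> insert None (Some ` W)" for P W :: "'a set"
      using that by auto
    show ?thesis
      unfolding cycle_free_lift B2_def
      by (intro ballI impI, elim conjE, rule free, assumption, erule drop)
  qed
  have "\<not> gammoid (space_matroid ?E ?Z)"
  proof
    assume gam: "gammoid (space_matroid ?E ?Z)"
    have sub: "B1 \<subseteq> ?E" "B2 \<subseteq> ?E" unfolding B1_def B2_def using JE xE n by auto
    have ne': "x 0 \<noteq> x 1" "x 0 \<noteq> x 2" "x 0 \<noteq> x 3" "x 0 \<noteq> x 4" "x 1 \<noteq> x 2" "x 1 \<noteq> x 3"
      "x 1 \<noteq> x 4" "x 2 \<noteq> x 3" "x 2 \<noteq> x 4" "x 3 \<noteq> x 4"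
      using n by (simp_all add: inj_on_eq_iff[OF x(1)])
    have xJ': "x 0 \<notin> J" "x 1 \<notin> J" "x 2 \<notin> J" "x 3 \<notin> J" "x 4 \<notin> J" using n by (auto intro!: xJ)
    have diff: "B1 - B2 = {Some (x 0), Some (x 1), Some (x 2)}" "B2 - B1 = {None, Some (x 3), Some (x 4)}"
      unfolding B1_def B2_def using ne' xJ' by auto
    have dep: "insert z B2 \<notin> indeps (space_matroid ?E ?Z)" if "z \<in> B1 - B2" for z
    proof -
      have "\<not> cycle_free ?Z (insert (Some (x 0)) B2)"
        by (rule dep_None[OF circuits(4)]) (auto simp: B2_def)
      moreover have "\<not> cycle_free ?Z (insert (Some (x 1)) B2)"
        by (rule dep_None[OF circuits(5)]) (auto simp: B2_def)
      moreover have "\<not> cycle_free ?Z (insert (Some (x 2)) B2)"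
        by (rule dep_None[OF circuits(2)]) (auto simp: B2_def)
      ultimately show ?thesis using that unfolding diff by auto
    qed
    obtain \<psi> where inj: "inj_on \<psi> (B1 - B2)" and \<psi>: "\<And>z. z \<in> B1 - B2 \<Longrightarrow> \<psi> z \<in> B2 - B1 \<and>
        cycle_free ?Z (insert (\<psi> z) (B1 - {z})) \<and> cycle_free ?Z (insert z (B2 - {\<psi> z}))"
    proof (rule gammoid_exchange[OF gam _ _ dep, of B1])
      show "B1 \<in> indeps (space_matroid ?E ?Z)" "B2 \<in> indeps (space_matroid ?E ?Z)"
        using free1 free2 sub by simp_all
    next
      fix \<psi>
      assume "inj_on \<psi> (B1 - B2)" "\<And>z. z \<in> B1 - B2 \<Longrightarrow> \<psi> z \<in> B2 - B1 \<and>
        insert (\<psi> z) (B1 - {z}) \<in> indeps (space_matroid ?E ?Z) \<and>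
        insert z (B2 - {\<psi> z}) \<in> indeps (space_matroid ?E ?Z)"
      then show thesis by (intro that[of \<psi>]) simp_all
    qed
    have m: "Some (x 1) \<in> B1 - B2" "Some (x 2) \<in> B1 - B2" unfolding diff by auto
    have "\<psi> (Some (x 1)) = Some (x 3)"
    proof -
      have "\<not> cycle_free ?Z (insert (Some (x 1)) (B2 - {None}))"
        by (rule dep_even[OF circuits(5)]) (auto simp: B2_def)
      moreover have "\<not> cycle_free ?Z (insert (Some (x 4)) (B1 - {Some (x 1)}))"
        by (rule dep_even[OF circuits(3)]) (use ne' xJ' in \<open>auto simp: B1_def\<close>)
      ultimately show ?thesis using \<psi>[OF m(1)] unfolding diff by auto
    qed
    moreover have "\<psi> (Some (x 2)) = Some (x 3)"
    proof -
      have "\<not> cycle_free ?Z (insert None (B1 - {Some (x 2)}))"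
        by (rule dep_None[OF circuits(1)]) (use ne' xJ' in \<open>auto simp: B1_def\<close>)
      moreover have "\<not> cycle_free ?Z (insert (Some (x 2)) (B2 - {Some (x 4)}))"
        by (rule dep_None[OF circuits(2)]) (use ne' xJ' in \<open>auto simp: B2_def\<close>)
      ultimately show ?thesis using \<psi>[OF m(2)] unfolding diff by auto
    qed
    ultimately show False using inj_on_eq_iff[OF inj m] ne'(5) by simp
  qed
  then show ?thesis using HE cardH by blast
qed

end

section \<open>Fundamental circuits without a minor M(G6)\<close>

lemma all_subsets3:
  "(\<forall>T \<subseteq> {e, f, g}. T \<noteq> {} \<longrightarrow> P T) \<longleftrightarrow>
    P {e} \<and> P {f} \<and> P {g} \<and> P {e, f} \<and> P {e, g} \<and> P {f, g} \<and> P {e, f, g}"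
proof -
  have "(\<forall>T \<subseteq> {e, f, g}. T \<noteq> {} \<longrightarrow> P T) \<longleftrightarrow> (\<forall>T \<in> Pow {e, f, g}. T \<noteq> {} \<longrightarrow> P T)"
    unfolding Ball_def Pow_iff by (rule refl)
  then show ?thesis by (simp add: Pow_insert conj_ac)
qed

context cycle_space_basis
begin

text \<open>
  Contracting the part \<open>B - P\<close> of the basis and deleting all other elements except those of \<open>T0\<close> cuts
  out the submatrix with rows \<open>P\<close> and columns \<open>T0\<close>: its cycles are indexed by the subsets of \<open>T0\<close>.
\<close>

lemma indep_minor_basis:
  assumes P: "P \<subseteq> B" and T0: "T0 \<subseteq> E - B"
  shows "X \<in> indeps (matroid_delete (matroid_contract (space_matroid E Z) (B - P)) (E - B - T0)) \<longleftrightarrow>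
    X \<subseteq> P \<union> T0 \<and>
    (\<forall>T \<subseteq> T0. T \<noteq> {} \<longrightarrow> \<not> T \<union> {y \<in> P. odd_count (\<lambda>t. y \<in> F t) T} \<subseteq> X)"
proof -
  let ?C = "B - P"
  have C: "?C \<subseteq> E" using basis_subset by blast
  have gr: "E - ?C - (E - B - T0) = P \<union> T0" using P T0 basis_subset by blast
  have "(\<forall>S \<in> Z. S \<subseteq> X \<union> ?C \<longrightarrow> S \<subseteq> ?C) \<longleftrightarrow>
      (\<forall>T \<subseteq> T0. T \<noteq> {} \<longrightarrow> \<not> T \<union> {y \<in> P. odd_count (\<lambda>t. y \<in> F t) T} \<subseteq> X)"
    if X: "X \<subseteq> P \<union> T0"
  proof (intro iffI allI ballI impI)
    fix T assume r: "\<forall>S \<in> Z. S \<subseteq> X \<union> ?C \<longrightarrow> S \<subseteq> ?C" and T: "T \<subseteq> T0" "T \<noteq> {}"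
    show "\<not> T \<union> {y \<in> P. odd_count (\<lambda>t. y \<in> F t) T} \<subseteq> X"
    proof
      assume sub: "T \<union> {y \<in> P. odd_count (\<lambda>t. y \<in> F t) T} \<subseteq> X"
      let ?S = "T \<union> {y \<in> B. odd_count (\<lambda>t. y \<in> F t) T}"
      have TB: "T \<inter> B = {}" "T \<subseteq> E" using T T0 by auto
      have SB: "?S - B = T" using TB by auto
      have "?S \<in> Z"
        unfolding cycle_iff SB using TB basis_subset by auto
      then have "?S \<subseteq> X \<union> ?C \<longrightarrow> ?S \<subseteq> ?C" by (rule bspec[OF r])
      moreover have "?S \<subseteq> X \<union> ?C" using sub by auto
      ultimately have "?S \<subseteq> ?C" by (rule mp)
      then show False using T(2) TB by auto
    qed
  next
    fix S assume r: "\<forall>T \<subseteq> T0. T \<noteq> {} \<longrightarrow> \<not> T \<union> {y \<in> P. odd_count (\<lambda>t. y \<in> F t) T} \<subseteq> X"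
      and S: "S \<in> Z" "S \<subseteq> X \<union> ?C"
    show "S \<subseteq> ?C"
    proof (rule ccontr)
      assume n: "\<not> S \<subseteq> ?C"
      have B: "y \<in> S \<longleftrightarrow> odd_count (\<lambda>t. y \<in> F t) (S - B)" if "y \<in> B" for y
        using S(1) that unfolding cycle_iff by blast
      have "S - B \<noteq> {}"
      proof
        assume empty: "S - B = {}"
        then have "y \<notin> S" if "y \<in> B" for y unfolding B[OF that] empty by simp
        then show False using n empty by auto
      qed
      moreover have "S - B \<subseteq> T0" using S(2) X P by auto
      moreover have "S - B \<union> {y \<in> P. odd_count (\<lambda>t. y \<in> F t) (S - B)} \<subseteq> X"
        using S(2) B P by auto
      ultimately show False using r by blast
    qed
  qed
  then show ?thesis unfolding indep_minor_iff[OF C] gr by blast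
qed

text \<open>
  The two submatrices of \<open>M(G6)\<close> in standard form, with rows \<open>b, b'\<close> and columns \<open>e, f, g\<close>. In the first
  the basis consists of one edge from each of the two parallel pairs and the columns are \<open>10, 01, 11\<close>.
  In the second it consists of an edge of one pair and the single edge, and the columns are
  \<open>11, 11, 10\<close>.
\<close>

lemma G6_minor_of_fundamental:
  assumes b: "b \<in> B" "b' \<in> B" and Q: "e \<in> E - B" "f \<in> E - B" "g \<in> E - B"
    and dist: "distinct [e, f, g]"
    and rows: "b \<in> F e \<and> b \<notin> F f \<and> b \<in> F g \<and> b' \<notin> F e \<and> b' \<in> F f \<and> b' \<in> F g \<or>
      b \<in> F e \<and> b \<in> F f \<and> b \<in> F g \<and> b' \<in> F e \<and> b' \<in> F f \<and> b' \<notin> F g"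
  shows "matroid_iso (matroid_delete (matroid_contract (space_matroid E Z) (B - {b, b'}))
    (E - B - {e, f, g})) (cycle_matroid G6)"
proof -
  let ?N = "matroid_delete (matroid_contract (space_matroid E Z) (B - {b, b'})) (E - B - {e, f, g})"
  have sub: "{b, b'} \<subseteq> B" "{e, f, g} \<subseteq> E - B" using b Q by auto
  have gr: "ground ?N = {b, b', e, f, g}"
    unfolding ground_minor using sub basis_subset by blast
  have ne: "b \<noteq> b'" using rows by auto
  have neq: "e \<noteq> f" "e \<noteq> g" "f \<noteq> g" "f \<noteq> e" "g \<noteq> e" "g \<noteq> f" using dist by auto
  have bne: "b \<noteq> e" "b \<noteq> f" "b \<noteq> g" "b' \<noteq> e" "b' \<noteq> f" "b' \<noteq> g" using b Q by auto
  have set: "{y \<in> {b, b'}. R y} \<subseteq> X \<longleftrightarrow> (R b \<longrightarrow> b \<in> X) \<and> (R b' \<longrightarrow> b' \<in> X)" for R X by auto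
  note ind = indep_minor_basis[OF sub, unfolded all_subsets3 Un_subset_iff set]
  from rows show ?thesis
  proof
    assume r: "b \<in> F e \<and> b \<notin> F f \<and> b \<in> F g \<and> b' \<notin> F e \<and> b' \<in> F f \<and> b' \<in> F g"
    show ?thesis
    proof (rule matroid_iso_G6I[of b e b' f g])
      show "distinct [b, e, b', f, g]" using ne neq bne by auto
      show "ground ?N = {b, e, b', f, g}" unfolding gr by auto
      show "X \<in> indeps ?N \<longleftrightarrow> X \<subseteq> ground ?N \<and>
          \<not> (b \<in> X \<and> e \<in> X) \<and> \<not> (b' \<in> X \<and> f \<in> X) \<and> \<not> (b \<in> X \<and> b' \<in> X \<and> g \<in> X) \<and>
          \<not> (b \<in> X \<and> f \<in> X \<and> g \<in> X) \<and> \<not> (e \<in> X \<and> b' \<in> X \<and> g \<in> X) \<and>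
          \<not> (e \<in> X \<and> f \<in> X \<and> g \<in> X)" for X
        unfolding ind gr using r neq by (auto simp: insert_commute)
    qed
  next
    assume r: "b \<in> F e \<and> b \<in> F f \<and> b \<in> F g \<and> b' \<in> F e \<and> b' \<in> F f \<and> b' \<notin> F g"
    show ?thesis
    proof (rule matroid_iso_G6I[of b g e f b'])
      show "distinct [b, g, e, f, b']" using ne neq bne by auto
      show "ground ?N = {b, g, e, f, b'}" unfolding gr by auto
      show "X \<in> indeps ?N \<longleftrightarrow> X \<subseteq> ground ?N \<and>
          \<not> (b \<in> X \<and> g \<in> X) \<and> \<not> (e \<in> X \<and> f \<in> X) \<and> \<not> (b \<in> X \<and> e \<in> X \<and> b' \<in> X) \<and>
          \<not> (b \<in> X \<and> f \<in> X \<and> b' \<in> X) \<and> \<not> (g \<in> X \<and> e \<in> X \<and> b' \<in> X) \<and>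
          \<not> (g \<in> X \<and> f \<in> X \<and> b' \<in> X)" for X
        unfolding ind gr using r neq by (auto simp: insert_commute)
    qed
  qed
qed

end

text \<open>
  By symmetry in \<open>e, f, g\<close>, the hypothesis makes meeting a transitive relation between the sets \<open>F e\<close> and
  the intersection of two meeting sets the same throughout an equivalence class.
\<close>

locale sunflower_basis = cycle_space_basis +
  assumes sunflower: "e \<in> E - B \<Longrightarrow> f \<in> E - B \<Longrightarrow> g \<in> E - B \<Longrightarrow> distinct [e, f, g] \<Longrightarrow>
    F e \<inter> F f \<noteq> {} \<Longrightarrow> F f \<inter> F g \<noteq> {} \<Longrightarrow> F e \<inter> F f \<subseteq> F g"

text \<open>
  Let \<open>b \<in> F e \<inter> F f\<close> and \<open>b' \<in> F f \<inter> F g\<close>. If \<open>b \<notin> F g\<close>, then the rows \<open>b\<close> and \<open>b'\<close> show one of the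
  two forbidden patterns, depending on whether \<open>b' \<in> F e\<close>.
\<close>

lemma (in cycle_space_basis) sunflower_if_no_G6:
  assumes no: "\<And>C D. C \<subseteq> E \<Longrightarrow> D \<subseteq> E \<Longrightarrow> C \<inter> D = {} \<Longrightarrow>
    \<not> matroid_iso (matroid_delete (matroid_contract (space_matroid E Z) C) D) (cycle_matroid G6)"
  shows "sunflower_basis E Z B F"
proof unfold_locales
  fix e f g assume Q: "e \<in> E - B" "f \<in> E - B" "g \<in> E - B" and dist: "distinct [e, f, g]"
    and meet: "F e \<inter> F f \<noteq> {}" "F f \<inter> F g \<noteq> {}"
  have bad: False if "b \<in> B" "b' \<in> B" "p \<in> E - B" "q \<in> E - B" "r \<in> E - B" "distinct [p, q, r]"
    "b \<in> F p \<and> b \<notin> F q \<and> b \<in> F r \<and> b' \<notin> F p \<and> b' \<in> F q \<and> b' \<in> F r \<or>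
      b \<in> F p \<and> b \<in> F q \<and> b \<in> F r \<and> b' \<in> F p \<and> b' \<in> F q \<and> b' \<notin> F r" for b b' p q r
  proof -
    have "\<not> matroid_iso (matroid_delete (matroid_contract (space_matroid E Z) (B - {b, b'}))
        (E - B - {p, q, r})) (cycle_matroid G6)"
      by (rule no) (use basis_subset in auto)
    then show False using G6_minor_of_fundamental[OF that] by simp
  qed
  show "F e \<inter> F f \<subseteq> F g"
  proof
    fix b assume b: "b \<in> F e \<inter> F f"
    obtain b' where b': "b' \<in> F f \<inter> F g" using meet(2) by auto
    have B: "b \<in> B" "b' \<in> B" using b b' fund Q by auto
    show "b \<in> F g"
    proof (rule ccontr)
      assume n: "b \<notin> F g"
      show False
      proof (cases "b' \<in> F e")
        case True
        show False by (rule bad[OF B(2,1) Q dist]) (use b b' n True in simp)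
      next
        case False
        show False by (rule bad[OF B Q(1,3,2)]) (use b b' n False dist in auto)
      qed
    qed
  qed
qed

context sunflower_basis
begin

text \<open>
  The common part of the sunflower that contains \<open>F e\<close>. It is empty if \<open>F e\<close> meets no other \<open>F f\<close>; the
  theta graph of such an \<open>e\<close> is a single circuit, whose second path has length zero.
\<close>

definition core :: "'a \<Rightarrow> 'a set" where
  "core e = (\<Union>f \<in> E - B - {e}. F e \<inter> F f)"

definition bunch :: "'a \<Rightarrow> 'a set" where
  "bunch e = {f \<in> E - B. f = e \<or> F e \<inter> F f \<noteq> {}}"

lemma core_eq_Int:
  assumes "e \<in> E - B" "f \<in> E - B" "e \<noteq> f" "F e \<inter> F f \<noteq> {}"
  shows "core e = F e \<inter> F f"
proof
  show "core e \<subseteq> F e \<inter> F f"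
  proof
    fix k assume "k \<in> core e"
    then obtain g where g: "g \<in> E - B" "g \<noteq> e" "k \<in> F e" "k \<in> F g"
      unfolding core_def by auto
    have "k \<in> F f"
    proof (cases "g = f")
      case False
      have "F g \<inter> F e \<subseteq> F f"
        by (rule sunflower) (use g assms False in auto)
      then show ?thesis using g by auto
    qed (use g in simp)
    then show "k \<in> F e \<inter> F f" using g by simp
  qed
  show "F e \<inter> F f \<subseteq> core e" unfolding core_def using assms by auto
qed

lemma core_subset: "core e \<subseteq> F e"
  unfolding core_def by auto

lemma mem_bunch_self: "e \<in> E - B \<Longrightarrow> e \<in> bunch e"
  unfolding bunch_def by simp

lemma core_bunch:
  assumes "e \<in> E - B" "f \<in> bunch e"
  shows "core f = core e"
proof (cases "f = e")
  case False
  then have "f \<in> E - B" "F e \<inter> F f \<noteq> {}" using assms(2) unfolding bunch_def by auto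
  then show ?thesis
    using core_eq_Int[of e f] core_eq_Int[of f e] assms(1) False by (simp add: Int_commute)
qed simp

lemma meeting_in_core:
  assumes "e \<in> E - B" "f \<in> E - B" "e \<noteq> f" "b \<in> F e" "b \<in> F f"
  shows "b \<in> core e \<and> f \<in> bunch e"
  using assms unfolding core_def bunch_def by auto

lemma bunch_sym: "e \<in> E - B \<Longrightarrow> f \<in> bunch e \<Longrightarrow> e \<in> bunch f"
  unfolding bunch_def by auto

lemma bunch_trans:
  assumes e: "e \<in> E - B" and f: "f \<in> bunch e" and g: "g \<in> bunch f"
  shows "g \<in> bunch e"
proof (cases "distinct [e, f, g]")
  case True
  have fg: "f \<in> E - B" "g \<in> E - B" "F e \<inter> F f \<noteq> {}" "F f \<inter> F g \<noteq> {}"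
    using True f g unfolding bunch_def by auto
  have "F e \<inter> F f \<subseteq> F g" by (rule sunflower) (use e fg True in auto)
  then have "F e \<inter> F g \<noteq> {}" using fg by auto
  then show ?thesis using fg unfolding bunch_def by simp
next
  case False
  then consider "e = f" | "f = g" | "e = g" by auto
  then show ?thesis using e f g mem_bunch_self by cases auto
qed

lemma bunch_eq:
  assumes "e \<in> E - B" "f \<in> bunch e"
  shows "bunch f = bunch e"
proof -
  have "f \<in> E - B" using assms(2) unfolding bunch_def by simp
  then show ?thesis using bunch_trans bunch_sym assms by (meson subset_antisym subsetI)
qed

lemma bunch_eq_iff:
  assumes "e \<in> E - B" "f \<in> E - B"
  shows "bunch e = bunch f \<longleftrightarrow> f \<in> bunch e"
  using assms bunch_eq mem_bunch_self by metis

lemma mem_core_iff: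
  assumes "e \<in> E - B" "k \<in> core e" "f \<in> E - B"
  shows "k \<in> F f \<longleftrightarrow> f \<in> bunch e"
proof
  assume "k \<in> F f"
  then show "f \<in> bunch e"
    using meeting_in_core[of e f k] mem_bunch_self[of e] assms core_subset by (cases "f = e") auto
next
  assume "f \<in> bunch e"
  then have "core f = core e" using assms(1) by (intro core_bunch)
  then show "k \<in> F f" using core_subset[of f] assms(2) by auto
qed

end


section \<open>A digraph for the element splittings\<close>

text \<open>
  The vertices are the elements of the splitting and two auxiliary vertices for each bunch. A bunch is
  named by the set of its members, so that all of them share these two vertices.
\<close>

datatype 'a hub = Elem "'a option" | Red "'a set" | Gate "'a set"

context sunflower_basis
begin

text \<open>
  The parity of \<open>H\<close> on the fundamental circuit, which consists of the petal \<open>{e} \<union> (F e - core e)\<close> and the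
  core: the parity of the petal relative to that of the core. The core itself thus counts as even.
\<close>

definition odd_on :: "'a set \<Rightarrow> 'a \<Rightarrow> bool" where
  "odd_on H e \<longleftrightarrow> odd (card (insert e (F e) \<inter> H))"

definition hub_verts :: "'a hub set" where
  "hub_verts = Elem ` insert None (Some ` E) \<union> Red ` bunch ` (E - B) \<union> Gate ` bunch ` (E - B)"

definition hub_sinks :: "'a hub set" where
  "hub_sinks = Elem ` insert None (Some ` B)"

text \<open>
  The basis elements and \<open>a\<close> are the sinks. If a petal is not entirely contained in the set to be linked,
  its element \<open>e\<close> escapes to a free basis element of the petal. Otherwise \<open>e\<close> must enter the vertex
  \<open>Red\<close> of its bunch if the petal is odd, and the vertex \<open>Gate\<close> if it is even, so a bunch holds at most
  one full petal of each parity. \<open>Gate\<close> leads only into the core: besides an even full petal, the core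
  may not be full. \<open>Red\<close> leads to \<open>Gate\<close> or to \<open>a\<close>. It has to use \<open>a\<close> exactly if the bunch contains
  a second full path, and this can happen in one bunch only.
\<close>

definition hub_arcs :: "'a set \<Rightarrow> 'a hub rel" where
  "hub_arcs H =
    {(Elem (Some e), Elem (Some b)) | e b. e \<in> E - B \<and> b \<in> F e - core e} \<union>
    {(Elem (Some e), Red (bunch e)) | e. e \<in> E - B \<and> odd_on H e} \<union>
    {(Elem (Some e), Gate (bunch e)) | e. e \<in> E - B \<and> \<not> odd_on H e} \<union>
    {(Red (bunch e), Gate (bunch e)) | e. e \<in> E - B} \<union>
    {(Red (bunch e), Elem None) | e. e \<in> E - B} \<union>
    {(Gate (bunch e), Elem (Some k)) | e k. e \<in> E - B \<and> k \<in> core e}"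

lemma hub_diff:
  "hub_verts - hub_sinks = Elem ` Some ` (E - B) \<union> Red ` bunch ` (E - B) \<union> Gate ` bunch ` (E - B)"
  unfolding hub_verts_def hub_sinks_def using basis_subset by (auto simp: image_iff)

lemma hub_finite: "finite hub_verts"
  unfolding hub_verts_def using finite_E by simp

lemma hub_arcs_subset: "hub_arcs H \<subseteq> hub_verts \<times> hub_verts"
proof -
  have V: "Elem None \<in> hub_verts" "\<And>e. e \<in> E \<Longrightarrow> Elem (Some e) \<in> hub_verts"
    "\<And>e. e \<in> E - B \<Longrightarrow> Red (bunch e) \<in> hub_verts"
    "\<And>e. e \<in> E - B \<Longrightarrow> Gate (bunch e) \<in> hub_verts"
    unfolding hub_verts_def by simp_all
  have F: "Elem (Some b) \<in> hub_verts" if "e \<in> E - B" "b \<in> F e" for e b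
    using V(2)[of b] F_subset[OF that(1)] that(2) basis_subset by blast
  have K: "Elem (Some b) \<in> hub_verts" if "e \<in> E - B" "b \<in> core e" for e b
    using F[OF that(1)] that(2) core_subset by blast
  have E: "Elem (Some e) \<in> hub_verts" if "e \<in> E - B" for e using that V(2) by simp
  show ?thesis
  proof (rule subrelI)
    fix u v assume "(u, v) \<in> hub_arcs H"
    then show "(u, v) \<in> hub_verts \<times> hub_verts"
      unfolding hub_arcs_def
      by (elim UnE CollectE exE conjE Pair_inject; hypsubst; intro SigmaI)
        (assumption | rule E V F K | erule DiffD1)+
  qed
qed

lemma arc_from_elem:
  "(Elem (Some e), v) \<in> hub_arcs H \<longleftrightarrow> e \<in> E - B \<and>
    ((\<exists>b \<in> F e - core e. v = Elem (Some b)) \<or>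
      v = (if odd_on H e then Red (bunch e) else Gate (bunch e)))"
  unfolding hub_arcs_def by auto

lemma arc_from_red:
  assumes "e \<in> E - B"
  shows "(Red (bunch e), v) \<in> hub_arcs H \<longleftrightarrow> v = Gate (bunch e) \<or> v = Elem None"
proof
  assume "(Red (bunch e), v) \<in> hub_arcs H"
  then show "v = Gate (bunch e) \<or> v = Elem None"
    unfolding hub_arcs_def by (elim UnE CollectE exE conjE) simp_all
next
  assume "v = Gate (bunch e) \<or> v = Elem None"
  then show "(Red (bunch e), v) \<in> hub_arcs H"
    unfolding hub_arcs_def using assms by (elim disjE; simp; blast)
qed

lemma arc_from_gate:
  assumes "e \<in> E - B"
  shows "(Gate (bunch e), v) \<in> hub_arcs H \<longleftrightarrow> (\<exists>k \<in> core e. v = Elem (Some k))"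
proof -
  have "core f = core e" if "f \<in> E - B" "bunch f = bunch e" for f
    using that assms core_bunch[of e f] bunch_eq_iff[of e f] by simp
  then have "(Gate (bunch e), v) \<in> hub_arcs H \<Longrightarrow> \<exists>k \<in> core e. v = Elem (Some k)"
    unfolding hub_arcs_def by (elim UnE CollectE exE conjE) simp_all
  moreover have "(Gate (bunch e), Elem (Some k)) \<in> hub_arcs H" if "k \<in> core e" for k
    unfolding hub_arcs_def using assms that by simp blast
  ultimately show ?thesis by auto
qed

text \<open>
  The sets \<open>F t\<close> with \<open>t \<noteq> e\<close> avoid the petal of \<open>e\<close>, so a cycle through \<open>e\<close> cannot leave out any of it.
\<close>

lemma mem_cycle_petal:
  assumes S: "S \<in> Z" and e: "e \<in> S - B" and b: "b \<in> F e - core e"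
  shows "b \<in> S"
proof -
  have sub: "S - B \<subseteq> E - B" using cycle_subset[OF S] by auto
  have eQ: "e \<in> E - B" using e sub by blast
  have bB: "b \<in> B" using b F_subset[OF eQ] by auto
  have "odd_count (\<lambda>t. b \<in> F t) (S - B)"
  proof (rule odd_count_single[OF e])
    fix t assume "t \<in> S - B"
    then have "t \<in> E - B" using sub by blast
    then show "b \<in> F t \<longleftrightarrow> t = e" using b meeting_in_core[OF eQ, of t b] by auto
  qed
  then show ?thesis using S bB unfolding cycle_iff by simp
qed

text \<open>
  An element of the core belongs to \<open>F t\<close> exactly for the members \<open>t\<close> of the bunch. So a cycle contains
  the core or avoids it, according to the number of petals of the bunch that it runs through.
\<close>

lemma mem_cycle_core:
  assumes S: "S \<in> Z" and e: "e \<in> E - B" and k: "k \<in> core e"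
  shows "k \<in> S \<longleftrightarrow> odd (card ((S - B) \<inter> bunch e))"
proof -
  have sub: "S - B \<subseteq> E - B" using cycle_subset[OF S] by auto
  have "k \<in> B" using k core_subset F_subset[OF e] by auto
  then have "k \<in> S \<longleftrightarrow> odd_count (\<lambda>t. k \<in> F t) (S - B)"
    using S unfolding cycle_iff by simp
  also have "{t \<in> S - B. k \<in> F t} = (S - B) \<inter> bunch e"
    using mem_core_iff[OF e k] sub by auto
  then have "odd_count (\<lambda>t. k \<in> F t) (S - B) \<longleftrightarrow> odd (card ((S - B) \<inter> bunch e))"
    unfolding odd_count_def by simp
  finally show ?thesis .
qed

text \<open>
  The parity of \<open>S \<inter> H\<close> is additive in \<open>S\<close>.
\<close>

lemma odd_cycle_iff:
  assumes S: "S \<in> Z"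
  shows "odd (card (S \<inter> H)) \<longleftrightarrow> odd_count (odd_on H) (S - B)"
proof -
  have sub: "S - B \<subseteq> E - B" using cycle_subset[OF S] by auto
  have fin: "finite (insert e (F e))" if "e \<in> S - B" for e
  proof -
    have "e \<in> E - B" using that sub by blast
    then have "insert e (F e) \<subseteq> E" using F_subset[of e] basis_subset by auto
    then show ?thesis using finite_E by (rule finite_subset)
  qed
  have "odd (card (S \<inter> H)) \<longleftrightarrow> odd (card (cyc_comb (\<lambda>e. insert e (F e)) (S - B) \<inter> H))"
    by (rule arg_cong[OF cycle_eq_comb[OF S], of "\<lambda>X. odd (card (X \<inter> H))"])
  also have "\<dots> \<longleftrightarrow> odd_count (odd_on H) (S - B)"
    unfolding odd_on_def using odd_card_cyc_comb[OF finite_cobasis_subset[OF sub] fin] .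
  finally show ?thesis .
qed

lemma cobasis_part_nonempty:
  assumes S: "S \<in> Z" "S \<noteq> {}"
  shows "S - B \<noteq> {}"
  using S basis_free unfolding cycle_free_def by blast

text \<open>
  Suppose that \<open>I\<close> is linked and contains a lifted cycle. All petals of this cycle are full, so their
  elements occupy \<open>Red\<close> or \<open>Gate\<close>. In each bunch that the cycle meets there are either a single petal
  and a full core, or a petal of each parity; in both cases \<open>Gate\<close> is unavailable to \<open>Red\<close>, which is
  occupied and must use \<open>a\<close>. Hence the cycle meets one bunch only, it is odd, and its lift contains
  \<open>a\<close>, so that \<open>a\<close> belongs to \<open>I\<close> and cannot be used by \<open>Red\<close>.
\<close>

lemma routes_imp_cycle_free:
  assumes I: "I \<subseteq> insert None (Some ` E)"
    and f: "routes hub_verts (hub_arcs H) hub_sinks (Elem ` I) f"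
  shows "cycle_free (lift_cycle H ` Z) I"
  unfolding cycle_free_lift
proof (intro ballI impI, rule ccontr)
  fix S assume S: "S \<in> Z" "S \<noteq> {}"
    and in_I: "Some ` S \<subseteq> I \<and> (odd (card (S \<inter> H)) \<longrightarrow> None \<in> I)"
  define T where "T = S - B"
  have TQ: "t \<in> E - B" if "t \<in> T" for t using that cycle_subset[OF S(1)] unfolding T_def by auto
  have step: "f v = v \<or> (v, f v) \<in> hub_arcs H" "f v \<in> hub_verts" "f v \<notin> Elem ` I"
    if "v \<in> hub_verts - hub_sinks" for v
    using f that unfolding routes_def by auto
  have dom: "Elem (Some e) \<in> hub_verts - hub_sinks" "Red (bunch e) \<in> hub_verts - hub_sinks"
    "Gate (bunch e) \<in> hub_verts - hub_sinks" if "e \<in> E - B" for e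
    unfolding hub_diff using that by simp_all
  have inj: "u = v" if "u \<in> hub_verts - hub_sinks" "v \<in> hub_verts - hub_sinks" "f u = f v" for u v
    using f that unfolding routes_def by (auto dest: inj_onD)
  have occupied: "Elem (Some s) \<in> Elem ` I" if "s \<in> S" for s using that in_I by auto
  have out: "f (Elem (Some e)) = (if odd_on H e then Red (bunch e) else Gate (bunch e))"
    if e: "e \<in> T" for e
  proof -
    note d = dom(1)[OF TQ[OF e]]
    have "e \<in> S" using e unfolding T_def by simp
    then have "f (Elem (Some e)) \<noteq> Elem (Some e)" using step(3)[OF d] occupied by metis
    moreover have "f (Elem (Some e)) \<noteq> Elem (Some b)" if "b \<in> F e - core e" for b
      using step(3)[OF d] occupied mem_cycle_petal[OF S(1) _ that] e unfolding T_def by metis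
    ultimately show ?thesis using step(1)[OF d] unfolding arc_from_elem by blast
  qed
  have gate: "f (Gate (bunch e)) = Gate (bunch e)" if e: "e \<in> T" and odd: "odd (card (T \<inter> bunch e))" for e
  proof -
    note d = dom(3)[OF TQ[OF e]]
    have "f (Gate (bunch e)) \<noteq> Elem (Some k)" if "k \<in> core e" for k
      using step(3)[OF d] occupied mem_cycle_core[OF S(1) TQ[OF e] that] odd
      unfolding T_def by metis
    then show ?thesis using step(1)[OF d] unfolding arc_from_gate[OF TQ[OF e]] by blast
  qed
  have same: "s = t" if "s \<in> T \<inter> bunch e" "t \<in> T \<inter> bunch e" "odd_on H s = odd_on H t" "e \<in> T" for s t e
  proof -
    have "bunch s = bunch t" using that bunch_eq[OF TQ[OF that(4)]] by simp
    then have "f (Elem (Some s)) = f (Elem (Some t))" using out that by simp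
    then show ?thesis using inj[OF dom(1) dom(1)] TQ that by blast
  qed
  have key: "f (Red (bunch e)) = Elem None \<and> odd (card {t \<in> T \<inter> bunch e. odd_on H t})"
    if e: "e \<in> T" for e
  proof -
    have eQ: "e \<in> E - B" using e by (rule TQ)
    have eT: "e \<in> T \<inter> bunch e" using e mem_bunch_self[OF eQ] by simp
    have grp: "bunch t = bunch e" if "t \<in> T \<inter> bunch e" for t using that bunch_eq[OF eQ] by simp
    have free: "f (Red (bunch e)) = Elem None"
      if "f u = Red (bunch e)" "u \<in> hub_verts - hub_sinks" "u \<noteq> Red (bunch e)"
        "f w = Gate (bunch e)" "w \<in> hub_verts - hub_sinks" "w \<noteq> Red (bunch e)" for u w
    proof -
      have "f (Red (bunch e)) \<noteq> Red (bunch e)" "f (Red (bunch e)) \<noteq> Gate (bunch e)"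
        using that inj[OF dom(2)[OF eQ]] by metis+
      then show ?thesis using step(1)[OF dom(2)[OF eQ]] unfolding arc_from_red[OF eQ] by blast
    qed
    show ?thesis
    proof (cases "\<exists>b \<in> T \<inter> bunch e. \<not> odd_on H b")
      case True
      then obtain b where b: "b \<in> T \<inter> bunch e" "\<not> odd_on H b" by blast
      have bQ: "b \<in> E - B" using b(1) TQ by blast
      have fb: "f (Elem (Some b)) = Gate (bunch e)" using out[of b] b grp[OF b(1)] by simp
      have "f (Gate (bunch e)) \<noteq> Gate (bunch e)"
        using inj[OF dom(1)[OF bQ] dom(3)[OF eQ]] fb by (metis hub.distinct(3))
      then have "even (card (T \<inter> bunch e))" using gate[OF e] by blast
      then have "T \<inter> bunch e \<noteq> {b}" by auto
      then obtain r where r: "r \<in> T \<inter> bunch e" "r \<noteq> b" using b(1) by blast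
      have hr: "odd_on H r" using same[OF r(1) b(1) _ e] r(2) b(2) by blast
      have rQ: "r \<in> E - B" using r(1) TQ by blast
      have fr: "f (Elem (Some r)) = Red (bunch e)" using out[of r] r hr grp[OF r(1)] by simp
      have "{t \<in> T \<inter> bunch e. odd_on H t} = {r}"
      proof (intro equalityI subsetI)
        fix t assume t: "t \<in> {t \<in> T \<inter> bunch e. odd_on H t}"
        then have "t \<in> T \<inter> bunch e" "odd_on H t = odd_on H r" using hr by simp_all
        then show "t \<in> {r}" using same[OF _ r(1) _ e] by simp
      qed (use r(1) hr in simp)
      moreover have "f (Red (bunch e)) = Elem None"
        by (rule free[OF fr dom(1)[OF rQ] _ fb dom(1)[OF bQ]]) simp_all
      ultimately show ?thesis by simp
    next
      case False
      have he: "odd_on H e" using False eT by blast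
      have single: "T \<inter> bunch e = {e}"
      proof (intro equalityI subsetI)
        fix t assume t: "t \<in> T \<inter> bunch e"
        then have "odd_on H t" using False by blast
        then show "t \<in> {e}" using same[OF t eT _ e] he by simp
      qed (use eT in simp)
      have fg: "f (Gate (bunch e)) = Gate (bunch e)" using gate[OF e] single by simp
      have fe: "f (Elem (Some e)) = Red (bunch e)" using out[OF e] he by simp
      have "f (Red (bunch e)) = Elem None"
        by (rule free[OF fe dom(1)[OF eQ] _ fg dom(3)[OF eQ]]) simp_all
      moreover have "{t \<in> T \<inter> bunch e. odd_on H t} = {e}" unfolding single using he by auto
      ultimately show ?thesis by simp
    qed
  qed
  obtain e where e: "e \<in> T" using cobasis_part_nonempty[OF S] unfolding T_def by blast
  have eQ: "e \<in> E - B" using e by (rule TQ)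
  have "T \<subseteq> bunch e"
  proof
    fix t assume t: "t \<in> T"
    have "f (Red (bunch t)) = f (Red (bunch e))" using key[OF t] key[OF e] by simp
    then have "bunch t = bunch e" using inj[OF dom(2)[OF TQ[OF t]] dom(2)[OF eQ]] by simp
    then show "t \<in> bunch e" using mem_bunch_self[OF TQ[OF t]] by simp
  qed
  then have "T \<inter> bunch e = T" by blast
  then have "odd_count (odd_on H) T" using key[OF e] unfolding odd_count_def by simp
  then have "odd (card (S \<inter> H))" using odd_cycle_iff[OF S(1)] unfolding T_def by simp
  then have "None \<in> I" using in_I by blast
  then show False using key[OF e] step(3)[OF dom(2)[OF eQ]] by simp
qed

text \<open>
  The routing is dictated by the digraph once it is known which petals are full. Independence supplies
  what makes it injective: two full petals of a bunch have different parities, an even full petal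
  precludes a full core, and at most one bunch is bad, that is, carries an odd cycle inside \<open>I\<close>, because
  the sum of two odd cycles is even. A bad bunch also excludes \<open>a \<in> I\<close>, as otherwise the lift of its odd
  cycle would lie in \<open>I\<close>.
\<close>

lemma cycle_free_imp_routes:
  assumes I: "I \<subseteq> insert None (Some ` E)" and free: "cycle_free (lift_cycle H ` Z) I"
  shows "\<exists>f. routes hub_verts (hub_arcs H) hub_sinks (Elem ` I) f"
proof -
  define used where "used e \<longleftrightarrow> Some e \<in> I" for e
  have no_cycle: "S = {}" if "S \<in> Z" "\<And>s. s \<in> S \<Longrightarrow> used s" "odd (card (S \<inter> H)) \<Longrightarrow> None \<in> I" for S
    using free that unfolding cycle_free_lift used_def by blast
  \<comment> \<open>the whole petal lies in \<open>I\<close>\<close>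
  define full where "full e \<longleftrightarrow> used e \<and> (\<forall>b \<in> F e - core e. used b)" for e
  \<comment> \<open>bunches whose \<open>Red\<close> vertex, if it is entered, has to use \<open>a\<close>\<close>
  define bad where "bad g \<longleftrightarrow> (\<exists>S \<in> Z. (\<forall>s \<in> S. used s) \<and> S - B \<subseteq> g \<and> odd (card (S \<inter> H)))" for g
  define red where "red g \<longleftrightarrow> (\<exists>e \<in> E - B. bunch e = g \<and> full e \<and> odd_on H e)" for g
  define blue where "blue g \<longleftrightarrow> (\<exists>e \<in> E - B. bunch e = g \<and> full e \<and> \<not> odd_on H e)" for g
  have bad_None: "None \<notin> I" if "bad g" for g
  proof
    assume "None \<in> I"
    obtain S where S: "S \<in> Z" "\<forall>s \<in> S. used s" "odd (card (S \<inter> H))"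
      using \<open>bad g\<close> unfolding bad_def by blast
    have "S = {}" by (rule no_cycle[OF S(1)]) (use S(2) \<open>None \<in> I\<close> in auto)
    then show False using S(3) by simp
  qed
  have bad_unique: "bunch e = bunch e'" if e: "e \<in> E - B" "e' \<in> E - B" and b: "bad (bunch e)" "bad (bunch e')" for e e'
  proof -
    obtain S where S: "S \<in> Z" "\<forall>s \<in> S. used s" "S - B \<subseteq> bunch e" "odd (card (S \<inter> H))"
      using b(1) unfolding bad_def by blast
    obtain S' where S': "S' \<in> Z" "\<forall>s \<in> S'. used s" "S' - B \<subseteq> bunch e'" "odd (card (S' \<inter> H))"
      using b(2) unfolding bad_def by blast
    have fin: "finite (S \<inter> H)" "finite (S' \<inter> H)"
      using finite_cycle[OF S(1)] finite_cycle[OF S'(1)] by simp_all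
    have "sym_diff S S' \<inter> H = sym_diff (S \<inter> H) (S' \<inter> H)" by blast
    then have even: "even (card (sym_diff S S' \<inter> H))"
      using odd_card_sym_diff[OF fin] S(4) S'(4) by simp
    have "sym_diff S S' = {}"
      by (rule no_cycle[OF sym_diff_cycle[OF S(1) S'(1)]]) (use S(2) S'(2) even in auto)
    then have "S = S'" by blast
    moreover have "S \<noteq> {}" using S(4) by auto
    ultimately obtain t where t: "t \<in> bunch e" "t \<in> bunch e'"
      using cobasis_part_nonempty[OF S(1)] S(3) S'(3) by blast
    then show ?thesis using bunch_eq[OF e(1)] bunch_eq[OF e(2)] by metis
  qed
  have fundamental: "insert e (F e) \<in> Z" "F e \<subseteq> B" "e \<notin> B" if "e \<in> E - B" for e
    using fund[OF that] that by auto
  have free_core: "\<exists>k \<in> core e. \<not> used k" if e: "e \<in> E - B" "full e" and nb: "\<not> odd_on H e \<or> \<not> bad (bunch e)" for e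
  proof (rule ccontr)
    assume "\<not> (\<exists>k \<in> core e. \<not> used k)"
    then have used: "used s" if "s \<in> insert e (F e)" for s using that e(2) unfolding full_def by auto
    have "odd_on H e"
    proof (rule ccontr)
      assume n: "\<not> odd_on H e"
      have "insert e (F e) = {}"
        by (rule no_cycle[OF fundamental(1)[OF e(1)] used]) (use n in \<open>simp_all add: odd_on_def\<close>)
      then show False by simp
    qed
    moreover have "insert e (F e) - B \<subseteq> bunch e"
      using fundamental[OF e(1)] mem_bunch_self[OF e(1)] by auto
    ultimately have "bad (bunch e)"
      unfolding bad_def odd_on_def using fundamental(1)[OF e(1)] used by blast
    then show False using nb \<open>odd_on H e\<close> by simp
  qed
  have two_full: "odd_on H e \<noteq> odd_on H e' \<and> bad (bunch e)"
    if e: "e \<in> E - B" "full e" and e': "e' \<in> E - B" "full e'" and gr: "bunch e = bunch e'" and ne: "e \<noteq> e'" for e e'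
  proof -
    let ?C = "insert e (F e)" and ?C' = "insert e' (F e')"
    let ?S = "sym_diff ?C ?C'"
    have SZ: "?S \<in> Z" using fundamental(1)[OF e(1)] fundamental(1)[OF e'(1)] by (rule sym_diff_cycle)
    have fin: "finite (?C \<inter> H)" "finite (?C' \<inter> H)"
      using finite_cycle[OF fundamental(1)] e(1) e'(1) by blast+
    have "?S \<inter> H = sym_diff (?C \<inter> H) (?C' \<inter> H)" by blast
    then have par: "odd (card (?S \<inter> H)) \<longleftrightarrow> odd_on H e \<noteq> odd_on H e'"
      using odd_card_sym_diff[OF fin] unfolding odd_on_def by simp
    have ker: "core e' = core e"
      using core_bunch[OF e(1), of e'] gr bunch_eq_iff[OF e(1) e'(1)] by simp
    have used: "used s" if "s \<in> ?S" for s
      using that e(2) e'(2) core_subset[of e] core_subset[of e'] ker unfolding full_def by auto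
    have "e \<in> ?S" using fundamental[OF e(1)] fundamental[OF e'(1)] ne by auto
    then have "?S \<noteq> {}" by blast
    then have odd: "odd (card (?S \<inter> H))" using no_cycle[OF SZ used] by blast
    have "?S - B \<subseteq> {e, e'}" using fundamental[OF e(1)] fundamental[OF e'(1)] by auto
    then have "?S - B \<subseteq> bunch e"
      using mem_bunch_self[OF e(1)] mem_bunch_self[OF e'(1)] gr by auto
    then have "bad (bunch e)" unfolding bad_def using SZ used odd by blast
    then show ?thesis using odd par by simp
  qed
  have "\<exists>b. b \<in> F e - core e \<and> \<not> used b" if "used e" "\<not> full e" for e
    using that unfolding full_def by blast
  then obtain bp where bp: "\<And>e. used e \<Longrightarrow> \<not> full e \<Longrightarrow> bp e \<in> F e - core e \<and> \<not> used (bp e)"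
    by metis
  \<comment> \<open>bunches whose \<open>Gate\<close> vertex is entered, and so has to be left through the core\<close>
  define open_gate where "open_gate g \<longleftrightarrow> blue g \<or> red g \<and> \<not> bad g" for g
  have "\<exists>k. \<exists>e \<in> E - B. bunch e = g \<and> k \<in> core e \<and> \<not> used k" if "open_gate g" for g
    using that free_core unfolding open_gate_def blue_def red_def by blast
  then obtain kp where kp: "\<And>g. open_gate g \<Longrightarrow>
      \<exists>e \<in> E - B. bunch e = g \<and> kp g \<in> core e \<and> \<not> used (kp g)"
    by metis
  define f where "f v = (case v of
      Elem x \<Rightarrow> (case x of None \<Rightarrow> v | Some e \<Rightarrow>
        if \<not> used e then v else if \<not> full e then Elem (Some (bp e))
        else if odd_on H e then Red (bunch e) else Gate (bunch e))
    | Red g \<Rightarrow> if red g then if bad g then Elem None else Gate g else v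
    | Gate g \<Rightarrow> if open_gate g then Elem (Some (kp g)) else v)" for v
  have f_elem: "f (Elem (Some e)) = (if \<not> used e then Elem (Some e) else if \<not> full e then Elem (Some (bp e))
        else if odd_on H e then Red (bunch e) else Gate (bunch e))" for e
    unfolding f_def by simp
  have f_red: "f (Red g) = (if red g then if bad g then Elem None else Gate g else Red g)" for g
    unfolding f_def by simp
  have f_gate: "f (Gate g) = (if open_gate g then Elem (Some (kp g)) else Gate g)" for g
    unfolding f_def by simp
  have bpB: "bp e \<in> B" if "e \<in> E - B" "used e" "\<not> full e" for e
    using bp[OF that(2,3)] fundamental[OF that(1)] by blast
  have kpB: "kp g \<in> B" if "open_gate g" for g
    using kp[OF that] core_subset F_subset by blast
  have inj_elem: "inj_on f (Elem ` Some ` (E - B))"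
  proof (rule inj_onI)
    fix u v assume uv: "u \<in> Elem ` Some ` (E - B)" "v \<in> Elem ` Some ` (E - B)" "f u = f v"
    then obtain e e' where e: "u = Elem (Some e)" "v = Elem (Some e')" "e \<in> E - B" "e' \<in> E - B" by auto
    have eq: "f (Elem (Some e)) = f (Elem (Some e'))" using uv(3) e by simp
    have own: "e = e'" if "used e" "\<not> full e" "used e'" "\<not> full e'" "bp e = bp e'"
      using bp[OF that(1,2)] bp[OF that(3,4)] that(5) meeting_in_core[OF e(3,4), of "bp e"] by auto
    have full: "e = e'" if "full e" "full e'" "odd_on H e = odd_on H e'" "bunch e = bunch e'"
      using two_full[OF e(3) that(1) e(4) that(2) that(4)] that(3) by blast
    have ne: "bp e \<noteq> e'" if "used e" "\<not> full e" using bpB[OF e(3) that] e(4) by auto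
    have ne': "bp e' \<noteq> e" if "used e'" "\<not> full e'" using bpB[OF e(4) that] e(3) by auto
    have "e = e'"
      using eq own full ne ne' unfolding f_elem by (auto split: if_splits)
    then show "u = v" using e by simp
  qed
  have inj_red: "inj_on f (Red ` bunch ` (E - B))"
  proof (rule inj_onI)
    fix u v assume uv: "u \<in> Red ` bunch ` (E - B)" "v \<in> Red ` bunch ` (E - B)" "f u = f v"
    then obtain e e' where e: "u = Red (bunch e)" "v = Red (bunch e')" "e \<in> E - B" "e' \<in> E - B" by auto
    have "f (Red (bunch e)) = f (Red (bunch e'))" using uv(3) e by simp
    then have "bunch e = bunch e'"
      using bad_unique[OF e(3,4)] unfolding f_red by (auto split: if_splits)
    then show "u = v" using e by simp
  qed
  have inj_gate: "inj_on f (Gate ` bunch ` (E - B))"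
  proof (rule inj_onI)
    fix u v assume uv: "u \<in> Gate ` bunch ` (E - B)" "v \<in> Gate ` bunch ` (E - B)" "f u = f v"
    then obtain e e' where e: "u = Gate (bunch e)" "v = Gate (bunch e')" by auto
    have "bunch e = bunch e'" if o: "open_gate (bunch e)" "open_gate (bunch e')" and k: "kp (bunch e) = kp (bunch e')"
    proof -
      obtain d where d: "d \<in> E - B" "bunch d = bunch e" "kp (bunch e) \<in> core d" using kp[OF o(1)] by blast
      obtain d' where d': "d' \<in> E - B" "bunch d' = bunch e'" "kp (bunch e') \<in> core d'" using kp[OF o(2)] by blast
      have "kp (bunch e) \<in> F d'" using k d'(3) core_subset[of d'] by auto
      then have "d' \<in> bunch d" using mem_core_iff[OF d(1,3) d'(1)] by simp
      then show ?thesis using bunch_eq[OF d(1)] d(2) d'(2) by simp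
    qed
    then show "u = v" using uv(3) e unfolding f_gate e by (auto split: if_splits)
  qed
  have elem_red: "f (Elem (Some e)) \<noteq> f (Red (bunch e'))" if e: "e \<in> E - B" and e': "e' \<in> E - B" for e e'
  proof
    assume eq: "f (Elem (Some e)) = f (Red (bunch e'))"
    have u: "used e" "full e" using eq unfolding f_elem f_red by (auto split: if_splits)
    show False
    proof (cases "odd_on H e")
      case True
      then have "f (Elem (Some e)) = Red (bunch e)" "red (bunch e)"
        using u e unfolding f_elem red_def by auto
      then show False using eq unfolding f_red by (auto split: if_splits)
    next
      case False
      then have "f (Elem (Some e)) = Gate (bunch e)" using u unfolding f_elem by simp
      then have gr: "bunch e = bunch e'" "red (bunch e)" "\<not> bad (bunch e)"
        using eq unfolding f_red by (auto split: if_splits)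
      then obtain r where r: "r \<in> E - B" "bunch r = bunch e" "full r" "odd_on H r"
        unfolding red_def by blast
      have "e \<noteq> r" using r(4) False by blast
      then show False using two_full[OF e u(2) r(1,3) r(2)[symmetric]] gr(3) by blast
    qed
  qed
  have elem_gate: "f (Elem (Some e)) \<noteq> f (Gate (bunch e'))" if e: "e \<in> E - B" and e': "e' \<in> E - B" for e e'
  proof
    assume eq: "f (Elem (Some e)) = f (Gate (bunch e'))"
    show False
    proof (cases "used e \<and> full e")
      case True
      then have "\<not> odd_on H e" "bunch e = bunch e'" "\<not> open_gate (bunch e')"
        using eq unfolding f_elem f_gate by (auto split: if_splits)
      then show False using True e unfolding open_gate_def blue_def by auto
    next
      case False
      then have o: "open_gate (bunch e')" using eq unfolding f_elem f_gate by (auto split: if_splits)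
      then obtain d where d: "d \<in> E - B" "kp (bunch e') \<in> core d" using kp[OF o] by blast
      have "used e"
      proof (rule ccontr)
        assume "\<not> used e"
        then have "e = kp (bunch e')" using eq o unfolding f_elem f_gate by simp
        then show False using kpB[OF o] e by auto
      qed
      then have u: "used e" "\<not> full e" using False by auto
      then have k: "bp e = kp (bunch e')" using eq o unfolding f_elem f_gate by simp
      have b: "bp e \<in> F e - core e" using bp[OF u] by blast
      have "bp e \<in> core d" using d(2) k by simp
      moreover from this have "e \<in> bunch d" using mem_core_iff[OF d(1) _ e] b by blast
      ultimately show False using core_bunch[OF d(1)] b by auto
    qed
  qed
  have red_gate: "f (Red g) \<noteq> f (Gate g')" for g g'
    unfolding f_red f_gate open_gate_def by auto
  have "inj_on f (hub_verts - hub_sinks)"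
    unfolding hub_diff inj_on_Un
    using inj_elem inj_red inj_gate elem_red elem_gate red_gate by (auto 0 3)
  moreover have "f v \<in> hub_verts - Elem ` I \<and> (f v = v \<or> (v, f v) \<in> hub_arcs H)"
    if v: "v \<in> hub_verts - hub_sinks" for v
  proof -
    have "f v \<notin> Elem ` I \<and> (f v = v \<or> (v, f v) \<in> hub_arcs H)"
      using v[unfolded hub_diff]
    proof (elim UnE imageE)
      fix x e assume "v = Elem x" "x = Some e" "e \<in> E - B"
      then have e: "v = Elem (Some e)" "e \<in> E - B" by simp_all
      have "bp e \<in> F e - core e \<and> Some (bp e) \<notin> I" if "used e" "\<not> full e"
        using bp[OF that] unfolding used_def by simp
      then show ?thesis
        unfolding e(1) f_elem arc_from_elem using e(2) unfolding used_def by auto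
    next
      fix x e assume "v = Red x" "x = bunch e" "e \<in> E - B"
      then have e: "v = Red (bunch e)" "e \<in> E - B" by simp_all
      show ?thesis unfolding e(1) f_red arc_from_red[OF e(2)] using bad_None by auto
    next
      fix x e assume "v = Gate x" "x = bunch e" "e \<in> E - B"
      then have e: "v = Gate (bunch e)" "e \<in> E - B" by simp_all
      have "kp (bunch e) \<in> core e \<and> Some (kp (bunch e)) \<notin> I" if o: "open_gate (bunch e)"
      proof -
        obtain d where d: "d \<in> E - B" "bunch d = bunch e" "kp (bunch e) \<in> core d" "\<not> used (kp (bunch e))"
          using kp[OF o] by blast
        have "core e = core d" using core_bunch[OF d(1), of e] bunch_eq_iff[OF d(1) e(2)] d(2) by simp
        then show ?thesis using d(3,4) unfolding used_def by simp
      qed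
      then show ?thesis unfolding e(1) f_gate arc_from_gate[OF e(2)] by auto
    qed
    moreover from this have "f v \<in> hub_verts" using v hub_arcs_subset by auto
    ultimately show ?thesis by simp
  qed
  ultimately show ?thesis unfolding routes_def by blast
qed

lemma routed_by_hub:
  "routed_by (space_matroid (insert None (Some ` E)) (lift_cycle H ` Z))
    hub_verts (hub_arcs H) hub_sinks Elem"
proof -
  have "hub_sinks \<subseteq> hub_verts" "Elem ` insert None (Some ` E) \<subseteq> hub_verts"
    unfolding hub_sinks_def hub_verts_def using basis_subset by auto
  moreover have "X \<in> indeps (space_matroid (insert None (Some ` E)) (lift_cycle H ` Z)) \<longleftrightarrow>
      (\<exists>f. routes hub_verts (hub_arcs H) hub_sinks (Elem ` X) f)"
    if "X \<subseteq> insert None (Some ` E)" for X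
    using that routes_imp_cycle_free[OF that] cycle_free_imp_routes[OF that] by auto
  ultimately show ?thesis
    unfolding routed_by_def using hub_finite hub_arcs_subset by (simp add: inj_on_def)
qed

end

section \<open>The characterization\<close>

theorem theorem1p6:
  fixes M :: "'a pre_matroid"
  assumes "binary_gammoid M"
  shows "(\<forall>H. H \<subseteq> ground M \<and> card H \<ge> 3 \<longrightarrow> binary_gammoid (element_splitting M H)) \<longleftrightarrow>
    \<not> (\<exists>N. matroid_minor N M \<and> matroid_iso N (cycle_matroid G6))"
proof -
  have "binary M" using assms unfolding binary_gammoid_def by blast
  then obtain Z where Z: "cycle_space (ground M) Z" "M = space_matroid (ground M) Z"
    and split: "\<And>H. cycle_space (insert None (Some ` ground M)) (lift_cycle H ` Z) \<and>
      element_splitting M H = space_matroid (insert None (Some ` ground M)) (lift_cycle H ` Z) \<and>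
      binary (element_splitting M H)"
    by (rule binary_cycle_space) blast
  interpret cycle_space "ground M" Z by (rule Z(1))
  have minorI: "\<exists>N. matroid_minor N M \<and> matroid_iso N (cycle_matroid G6)"
    if CD: "C \<subseteq> ground M" "D \<subseteq> ground M" "C \<inter> D = {}" and
      iso: "matroid_iso (matroid_delete (matroid_contract (space_matroid (ground M) Z) C) D)
        (cycle_matroid G6)" for C D
  proof (intro exI conjI)
    show "matroid_minor (matroid_delete (matroid_contract M C) D) M"
      unfolding matroid_minor_def using CD by (intro exI[of _ C] exI[of _ D] conjI refl)
    show "matroid_iso (matroid_delete (matroid_contract M C) D) (cycle_matroid G6)"
      using iso unfolding Z(2)[symmetric] .
  qed
  show ?thesis
  proof
    assume all: "\<forall>H. H \<subseteq> ground M \<and> card H \<ge> 3 \<longrightarrow> binary_gammoid (element_splitting M H)"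
    show "\<not> (\<exists>N. matroid_minor N M \<and> matroid_iso N (cycle_matroid G6))"
    proof
      assume "\<exists>N. matroid_minor N M \<and> matroid_iso N (cycle_matroid G6)"
      then obtain C D where CD: "C \<subseteq> ground M" "D \<subseteq> ground M" "C \<inter> D = {}"
        and "matroid_iso (matroid_delete (matroid_contract M C) D) (cycle_matroid G6)"
        unfolding matroid_minor_def by auto
      then have "matroid_iso (matroid_delete (matroid_contract (space_matroid (ground M) Z) C) D)
          (cycle_matroid G6)"
        unfolding Z(2)[symmetric] by simp
      from splitting_not_gammoid[OF CD(1) this] obtain H where H: "H \<subseteq> ground M" "card H = 3"
        "\<not> gammoid (space_matroid (insert None (Some ` ground M)) (lift_cycle H ` Z))"
        by (elim exE conjE)
      have "binary_gammoid (element_splitting M H)" using all H(1,2) by simp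
      then show False using H(3) split[of H] unfolding binary_gammoid_def by simp
    qed
  next
    assume no: "\<not> (\<exists>N. matroid_minor N M \<and> matroid_iso N (cycle_matroid G6))"
    obtain B F where "cycle_space_basis (ground M) Z B F" by (rule basis_exists)
    then interpret cycle_space_basis "ground M" Z B F .
    have "sunflower_basis (ground M) Z B F"
    proof (rule sunflower_if_no_G6, rule notI)
      fix C D assume "C \<subseteq> ground M" "D \<subseteq> ground M" "C \<inter> D = {}"
        "matroid_iso (matroid_delete (matroid_contract (space_matroid (ground M) Z) C) D)
          (cycle_matroid G6)"
      then show False using no by (elim notE) (rule minorI)
    qed
    then interpret sunflower_basis "ground M" Z B F .
    have "binary_gammoid (element_splitting M H)" for H
    proof -
      have "matroid (space_matroid (insert None (Some ` ground M)) (lift_cycle H ` Z))"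
        using cycle_space.matroid_space split by blast
      then have "gammoid (space_matroid (insert None (Some ` ground M)) (lift_cycle H ` Z))"
        using routed_by_hub by (rule gammoidI)
      then have "gammoid (element_splitting M H)" using split[of H] by simp
      moreover have "binary (element_splitting M H)" using split[of H] by (elim conjE)
      ultimately show ?thesis unfolding binary_gammoid_def by (rule conjI)
    qed
    then show "\<forall>H. H \<subseteq> ground M \<and> card H \<ge> 3 \<longrightarrow> binary_gammoid (element_splitting M H)" by simp
  qed
qed

end
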